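(* Let $\mathbf{C}$ be a category with a terminal object and let $D:\mathbf{J}\to Z_{\mathbf{C}}$ be a diagram with $\mathbf{J}$ a non-empty connected (small) category. Then $D$ has a colimit in $Z_{\mathbf{C}}$ if and only if the zigzag colimit procedure (described in the context) succeeds on $D$, that is, if and only if: (1) the diagram $S_{\mathbf{C}}\circ D:\mathbf{J}\to\Delta$ has a colimit $[c]$ (with cocone $c_j : D(j)_{\mathrm{sing}}\to[c]$), and (2) for every $k\in[c]$ the diagram $(D_k)^*$ in $\mathbf{C}$ has a colimit. Moreover, when the procedure succeeds, the cocone $(f^j:D(j)\to C)_{j\in\mathbf{J}}$ that it constructs is a colimiting cocone of $D$.
   Context: **Monotone maps.** $[n]=\{0,\dots,n-1\}$ for $n\ge 0$. $\Delta$ is the category of finite, possibly empty, totally ordered sets and order-preserving maps; its objects are taken to be the $[n]$. For monotone $h:[n]\to[m]$, define $h':[m+1]\to[n+1]$ by $h'(j)=\min\{i\in[n+1] : i=n \text{ or } h(i)\ge j\}$ (monotone, with $h'(0)=0$, $h'(m)=n$). **Zigzags.** A zigzag $Z$ of length $n\ge 0$ in $\mathbf{C}$ consists of objects $r_0,\dots,r_n$ (regular objects) and $s_0,\dots,s_{n-1}$ (singular objects) and morphisms $f_i:r_i\to s_i$, $b_i:r_{i+1}\to s_i$ for $i\in[n]$. Write $Z_{\mathrm{sing}}=[n]$, $Z_{\mathrm{reg}}=[n+1]$, and use superscripts ($r_i^Z$ etc.) to indicate the zigzag. **Zigzag maps.** A zigzag map $g:Z\to Z'$ between zigzags of lengths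 $n,m$ consists of a monotone $g_{\mathrm{sing}}:[n]\to[m]$ and morphisms $g_i:s_i^Z\to s^{Z'}_{g_{\mathrm{sing}}(i)}$ for $i\in[n]$, such that, with $g_{\mathrm{reg}}=(g_{\mathrm{sing}})':[m+1]\to[n+1]$: (i) $r^{Z'}_j=r^Z_{g_{\mathrm{reg}}(j)}$ (equality of objects) for all $j\in[m+1]$; (ii) for $j\in[m]$ with $g_{\mathrm{sing}}^{-1}(j)=\emptyset$, $f^{Z'}_j=b^{Z'}_j$; (iii) for $j\in[m]$ with $g_{\mathrm{sing}}^{-1}(j)=\{p,p+1,\dots,q\}\neq\emptyset$, $f^{Z'}_j=g_p\circ f^Z_p$, $b^{Z'}_j=g_q\circ b^Z_q$, and $g_i\circ b^Z_i=g_{i+1}\circ f^Z_{i+1}$ for $p\le i<q$. Zigzags and zigzag maps form the category $Z_{\mathbf{C}}$, with composition given by composing the monotone maps and the singular components. The functor $S_{\mathbf{C}}:Z_{\mathbf{C}}\to\Delta$ sends $Z\mapsto Z_{\mathrm{sing}}$, $g\mapsto g_{\mathrm{sing}}$. **Restriction and concatenation.** For $a\le b$ in $Z_{\mathrm{reg}}$, $Z_{(a,b)}$ is the part of $Z$ from $r_a$ to $r_b$ inclusive (a zigzag of length $b-a$). For a zigzag map $g:Z\to Z'$ and $a\le b$ in $Z'_{\mathrm{reg}}$, $g_{(a,b)}:Z_{(g_{\mathrm{reg}}(a),g_{\mathrm{reg}}(b))}\to Z'_{(a,b)}$ is the evident restriction. Zigzags $Z,Z'$ with last regular object of $Z$ equal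 to first regular object of $Z'$ are concatenated by placing them side by side and identifying that object; zigzag maps are concatenated likewise. **Deconstruction.** For $E:\mathbf{J}\to Z_{\mathbf{C}}$, the deconstruction $E^*$ is the diagram in $\mathbf{C}$ with vertices $(j,r_i)$ for $j\in\mathbf{J}$, $i\in E(j)_{\mathrm{reg}}$, and $(j,s_i)$ for $i\in E(j)_{\mathrm{sing}}$, labelled by the corresponding regular/singular objects of $E(j)$; its arrows are $(j,r_i)\to(j,s_i)\leftarrow(j,r_{i+1})$ labelled $f_i^{E(j)},b_i^{E(j)}$, and for every $\sigma:j\to j'$ in $\mathbf{J}$: $(j,s_i)\to(j',s_{E(\sigma)_{\mathrm{sing}}(i)})$ labelled by the singular component $E(\sigma)_i$, and $(j',r_i)\to(j,r_{E(\sigma)_{\mathrm{reg}}(i)})$ labelled by an identity. **Zigzag colimit procedure** for $D:\mathbf{J}\to Z_{\mathbf{C}}$: 1. Take a colimit $[c]$ of $S_{\mathbf{C}}\circ D$ in $\Delta$, with cocone maps $c_j:D(j)_{\mathrm{sing}}\to[c]$; fail if none exists. 2. For each $k\in[c]$, let $D_k:\mathbf{J}\to Z_{\mathbf{C}}$ be the restricted diagram $D_k(j)=D(j)_{(c_j'(k),\,c_j'(k+1))}$, and $D_k(\sigma)=D(\sigma)_{(c_{j'}'(k),\,c_{j'}'(k+1))}$ for $\sigma:j\to j'$. Take a colimit $p$ of the deconstruction $(D_k)^*$ in $\mathbf{C}$; fail if none exists. Let $p^j_i:s_i^{D_k(j)}\to p$ ($j\in\mathbf{J}$, $i\in D_k(j)_{\mathrm{sing}}$)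 be its cocone maps at singular objects. Let $C_k$ be the zigzag of length 1 with singular object $p$, forward map $p^j_0\circ f_0^{D_k(j)}$ and backward map $p^j_{m-1}\circ b_{m-1}^{D_k(j)}$, where $j$ is any object of $\mathbf{J}$ such that $D_k(j)$ has length $m>0$ (the regular objects of $C_k$ being the sources of these maps). For each $j$ let $f^{j,k}:D_k(j)\to C_k$ be the zigzag map whose monotone map is the unique one to $[1]$ and whose singular components are the $p^j_i$. 3. $C$ is the concatenation of $C_0,\dots,C_{c-1}$, and $f^j:D(j)\to C$ is the concatenation of $f^{j,0},\dots,f^{j,c-1}$ (so $(f^j)_{\mathrm{sing}}=c_j$). If $c=0$, all $D(j)$ are the same length-0 zigzag, and $C$ is that zigzag. *)

theory Defs
  imports Main
begin

section \<open>Categories, functors and colimits\<close>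

record ('o, 'm) cat =
  Obj :: "'o set"
  Arr :: "'m set"
  Dom :: "'m \<Rightarrow> 'o"
  Cod :: "'m \<Rightarrow> 'o"
  Ident :: "'o \<Rightarrow> 'm"
  Comp :: "'m \<Rightarrow> 'm \<Rightarrow> 'm"

text \<open>\<open>Comp C g f\<close> is "first \<open>f\<close>, then \<open>g\<close>".\<close>

definition Hom :: "('o, 'm) cat \<Rightarrow> 'o \<Rightarrow> 'o \<Rightarrow> 'm set" where
  "Hom C x y = {f \<in> Arr C. Dom C f = x \<and> Cod C f = y}"

locale category =
  fixes C :: "('o, 'm) cat"
  assumes dom_obj: "f \<in> Arr C \<Longrightarrow> Dom C f \<in> Obj C"
    and cod_obj: "f \<in> Arr C \<Longrightarrow> Cod C f \<in> Obj C"
    and ident_hom: "x \<in> Obj C \<Longrightarrow> Ident C x \<in> Hom C x x"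
    and comp_hom: "f \<in> Hom C x y \<Longrightarrow> g \<in> Hom C y z \<Longrightarrow> Comp C g f \<in> Hom C x z"
    and comp_ident_right: "f \<in> Arr C \<Longrightarrow> Comp C f (Ident C (Dom C f)) = f"
    and comp_ident_left: "f \<in> Arr C \<Longrightarrow> Comp C (Ident C (Cod C f)) f = f"
    and comp_assoc: "f \<in> Hom C w x \<Longrightarrow> g \<in> Hom C x y \<Longrightarrow> h \<in> Hom C y z \<Longrightarrow>
                       Comp C h (Comp C g f) = Comp C (Comp C h g) f"

definition has_terminal :: "('o, 'm) cat \<Rightarrow> bool" where
  "has_terminal C \<longleftrightarrow> (\<exists>t\<in>Obj C. \<forall>x\<in>Obj C. \<exists>!f. f \<in> Hom C x t)"

definition connected_cat :: "('o, 'm) cat \<Rightarrow> bool" where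
  "connected_cat J \<longleftrightarrow> Obj J \<noteq> {} \<and>
     (let R = {(Dom J f, Cod J f) | f. f \<in> Arr J}
      in \<forall>x\<in>Obj J. \<forall>y\<in>Obj J. (x, y) \<in> (R \<union> R\<inverse>)\<^sup>*)"

record ('j, 'a, 'o, 'm) ftor =
  FObj :: "'j \<Rightarrow> 'o"
  FArr :: "'a \<Rightarrow> 'm"

definition is_functor :: "('j, 'a) cat \<Rightarrow> ('o, 'm) cat \<Rightarrow> ('j, 'a, 'o, 'm) ftor \<Rightarrow> bool" where
  "is_functor J C F \<longleftrightarrow>
     (\<forall>x\<in>Obj J. FObj F x \<in> Obj C) \<and>
     (\<forall>f\<in>Arr J. FArr F f \<in> Hom C (FObj F (Dom J f)) (FObj F (Cod J f))) \<and>
     (\<forall>x\<in>Obj J. FArr F (Ident J x) = Ident C (FObj F x)) \<and>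
     (\<forall>f\<in>Arr J. \<forall>g\<in>Arr J. Cod J f = Dom J g \<longrightarrow>
        FArr F (Comp J g f) = Comp C (FArr F g) (FArr F f))"

definition ftor_comp ::
  "('o, 'm, 'p, 'n) ftor \<Rightarrow> ('j, 'a, 'o, 'm) ftor \<Rightarrow> ('j, 'a, 'p, 'n) ftor" where
  "ftor_comp G F = \<lparr>FObj = \<lambda>x. FObj G (FObj F x), FArr = \<lambda>f. FArr G (FArr F f)\<rparr>"

text \<open>
  A diagram is a directed graph whose vertices are labelled by objects and whose arrows are
  labelled by morphisms; no commutativity is required.  A functor is a special case, and the
  (co)cones over a functor are those over its underlying labelled graph.
\<close>

record ('v, 'e, 'o, 'm) diagram =
  Verts :: "'v set"
  Edges :: "'e set"
  Src :: "'e \<Rightarrow> 'v"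
  Tgt :: "'e \<Rightarrow> 'v"
  VLab :: "'v \<Rightarrow> 'o"
  ELab :: "'e \<Rightarrow> 'm"

definition ftor_diagram ::
  "('j, 'a) cat \<Rightarrow> ('j, 'a, 'o, 'm) ftor \<Rightarrow> ('j, 'a, 'o, 'm) diagram" where
  "ftor_diagram J F =
     \<lparr>Verts = Obj J, Edges = Arr J, Src = Dom J, Tgt = Cod J, VLab = FObj F, ELab = FArr F\<rparr>"

definition is_cocone ::
  "('o, 'm) cat \<Rightarrow> ('v, 'e, 'o, 'm) diagram \<Rightarrow> 'o \<Rightarrow> ('v \<Rightarrow> 'm) \<Rightarrow> bool" where
  "is_cocone C G p \<phi> \<longleftrightarrow>
     p \<in> Obj C \<and>
     (\<forall>v\<in>Verts G. \<phi> v \<in> Hom C (VLab G v) p) \<and>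
     (\<forall>e\<in>Edges G. Comp C (\<phi> (Tgt G e)) (ELab G e) = \<phi> (Src G e))"

definition is_colimit ::
  "('o, 'm) cat \<Rightarrow> ('v, 'e, 'o, 'm) diagram \<Rightarrow> 'o \<Rightarrow> ('v \<Rightarrow> 'm) \<Rightarrow> bool" where
  "is_colimit C G p \<phi> \<longleftrightarrow>
     is_cocone C G p \<phi> \<and>
     (\<forall>q \<psi>. is_cocone C G q \<psi> \<longrightarrow>
        (\<exists>!u. u \<in> Hom C p q \<and> (\<forall>v\<in>Verts G. Comp C u (\<phi> v) = \<psi> v)))"

definition has_colimit :: "('o, 'm) cat \<Rightarrow> ('v, 'e, 'o, 'm) diagram \<Rightarrow> bool" where
  "has_colimit C G \<longleftrightarrow> (\<exists>p \<phi>. is_colimit C G p \<phi>)"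


section \<open>The category of finite ordinals\<close>

text \<open>
  The object \<open>[n]\<close> is the natural number \<open>n\<close>.  A monotone map \<open>h : [n] \<rightarrow> [m]\<close> is the list
  \<open>h(0), \<dots>, h(n - 1)\<close> of its values together with \<open>m\<close>, so that equality of morphisms is
  equality of representations.
\<close>

record mono_map =
  vals :: "nat list"
  mcod :: nat

definition mdom :: "mono_map \<Rightarrow> nat" where
  "mdom h = length (vals h)"

definition is_mono_map :: "mono_map \<Rightarrow> bool" where
  "is_mono_map h \<longleftrightarrow> sorted (vals h) \<and> (\<forall>i<mdom h. vals h ! i < mcod h)"

definition mono_comp :: "mono_map \<Rightarrow> mono_map \<Rightarrow> mono_map" where
  "mono_comp g h = \<lparr>vals = map (\<lambda>i. vals g ! i) (vals h), mcod = mcod g\<rparr>"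

definition Delta :: "(nat, mono_map) cat" where
  "Delta =
     \<lparr>Obj = UNIV, Arr = {h. is_mono_map h}, Dom = mdom, Cod = mcod,
      Ident = \<lambda>n. \<lparr>vals = [0..<n], mcod = n\<rparr>, Comp = mono_comp\<rparr>"

text \<open>The dual \<open>h' : [m + 1] \<rightarrow> [n + 1]\<close> of \<open>h : [n] \<rightarrow> [m]\<close>, as a function on indices \<open>j \<le> m\<close>.\<close>

definition dual :: "mono_map \<Rightarrow> nat \<Rightarrow> nat" where
  "dual h j = Min {i. i \<le> mdom h \<and> (i = mdom h \<or> vals h ! i \<ge> j)}"


section \<open>The category of zigzags\<close>

record ('o, 'm) zigzag =
  robj :: "'o list"
  sobj :: "'o list"
  fwd :: "'m list"
  bwd :: "'m list"

definition zlen :: "('o, 'm) zigzag \<Rightarrow> nat" where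
  "zlen Z = length (sobj Z)"

definition is_zigzag :: "('o, 'm) cat \<Rightarrow> ('o, 'm) zigzag \<Rightarrow> bool" where
  "is_zigzag C Z \<longleftrightarrow>
     length (robj Z) = zlen Z + 1 \<and> length (fwd Z) = zlen Z \<and> length (bwd Z) = zlen Z \<and>
     set (robj Z) \<subseteq> Obj C \<and> set (sobj Z) \<subseteq> Obj C \<and>
     (\<forall>i<zlen Z. fwd Z ! i \<in> Hom C (robj Z ! i) (sobj Z ! i) \<and>
                 bwd Z ! i \<in> Hom C (robj Z ! (i + 1)) (sobj Z ! i))"

record ('o, 'm) zmap =
  zdom :: "('o, 'm) zigzag"
  zcod :: "('o, 'm) zigzag"
  zsing :: mono_map
  zcomp :: "'m list"

definition zreg :: "('o, 'm) zmap \<Rightarrow> nat \<Rightarrow> nat" where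
  "zreg g = dual (zsing g)"

definition is_zmap :: "('o, 'm) cat \<Rightarrow> ('o, 'm) zmap \<Rightarrow> bool" where
  "is_zmap C g \<longleftrightarrow>
     (let Z = zdom g; Z' = zcod g; n = zlen Z; m = zlen Z'; h = vals (zsing g); gs = zcomp g in
      is_zigzag C Z \<and> is_zigzag C Z' \<and>
      zsing g \<in> Hom Delta n m \<and>
      length gs = n \<and> (\<forall>i<n. gs ! i \<in> Hom C (sobj Z ! i) (sobj Z' ! (h ! i))) \<and>
      (\<forall>j\<le>m. robj Z' ! j = robj Z ! zreg g j) \<and>
      (\<forall>j<m. let P = {i. i < n \<and> h ! i = j}; p = Min P; q = Max P in
         (P = {} \<longrightarrow> fwd Z' ! j = bwd Z' ! j) \<and>
         (P \<noteq> {} \<longrightarrow>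
            fwd Z' ! j = Comp C (gs ! p) (fwd Z ! p) \<and>
            bwd Z' ! j = Comp C (gs ! q) (bwd Z ! q) \<and>
            (\<forall>i. p \<le> i \<and> i < q \<longrightarrow>
               Comp C (gs ! i) (bwd Z ! i) = Comp C (gs ! (i + 1)) (fwd Z ! (i + 1))))))"

definition zid :: "('o, 'm) cat \<Rightarrow> ('o, 'm) zigzag \<Rightarrow> ('o, 'm) zmap" where
  "zid C Z = \<lparr>zdom = Z, zcod = Z, zsing = Ident Delta (zlen Z), zcomp = map (Ident C) (sobj Z)\<rparr>"

definition zmap_comp ::
  "('o, 'm) cat \<Rightarrow> ('o, 'm) zmap \<Rightarrow> ('o, 'm) zmap \<Rightarrow> ('o, 'm) zmap" where
  "zmap_comp C g f =
     \<lparr>zdom = zdom f, zcod = zcod g, zsing = Comp Delta (zsing g) (zsing f),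
      zcomp = map (\<lambda>i. Comp C (zcomp g ! (vals (zsing f) ! i)) (zcomp f ! i)) [0..<zlen (zdom f)]\<rparr>"

definition Zigzags :: "('o, 'm) cat \<Rightarrow> (('o, 'm) zigzag, ('o, 'm) zmap) cat" where
  "Zigzags C =
     \<lparr>Obj = {Z. is_zigzag C Z}, Arr = {g. is_zmap C g}, Dom = zdom, Cod = zcod,
      Ident = zid C, Comp = zmap_comp C\<rparr>"

definition Sing :: "(('o, 'm) zigzag, ('o, 'm) zmap, nat, mono_map) ftor" where
  "Sing = \<lparr>FObj = zlen, FArr = zsing\<rparr>"


section \<open>Restriction and concatenation\<close>

definition slice :: "nat \<Rightarrow> nat \<Rightarrow> 'x list \<Rightarrow> 'x list" where
  "slice a b xs = take (b - a) (drop a xs)"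

definition zrestrict :: "('o, 'm) zigzag \<Rightarrow> nat \<Rightarrow> nat \<Rightarrow> ('o, 'm) zigzag" where
  "zrestrict Z a b =
     \<lparr>robj = slice a (b + 1) (robj Z), sobj = slice a b (sobj Z),
      fwd = slice a b (fwd Z), bwd = slice a b (bwd Z)\<rparr>"

definition zmap_restrict :: "('o, 'm) zmap \<Rightarrow> nat \<Rightarrow> nat \<Rightarrow> ('o, 'm) zmap" where
  "zmap_restrict g a b =
     (let a' = zreg g a; b' = zreg g b in
      \<lparr>zdom = zrestrict (zdom g) a' b', zcod = zrestrict (zcod g) a b,
       zsing = \<lparr>vals = map (\<lambda>i. i - a) (slice a' b' (vals (zsing g))), mcod = b - a\<rparr>,
       zcomp = slice a' b' (zcomp g)\<rparr>)"

definition zconcat :: "('o, 'm) zigzag \<Rightarrow> ('o, 'm) zigzag \<Rightarrow> ('o, 'm) zigzag" where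
  "zconcat Z Z' =
     \<lparr>robj = robj Z @ tl (robj Z'), sobj = sobj Z @ sobj Z',
      fwd = fwd Z @ fwd Z', bwd = bwd Z @ bwd Z'\<rparr>"

definition zmap_concat :: "('o, 'm) zmap \<Rightarrow> ('o, 'm) zmap \<Rightarrow> ('o, 'm) zmap" where
  "zmap_concat g g' =
     \<lparr>zdom = zconcat (zdom g) (zdom g'), zcod = zconcat (zcod g) (zcod g'),
      zsing = \<lparr>vals = vals (zsing g) @ map (\<lambda>i. mcod (zsing g) + i) (vals (zsing g')),
               mcod = mcod (zsing g) + mcod (zsing g')\<rparr>,
      zcomp = zcomp g @ zcomp g'\<rparr>"

text \<open>\<open>concat_below op X c\<close> is \<open>X 0\<close>, \dots, \<open>X (c - 1)\<close> combined by \<open>op\<close>; only used for \<open>c > 0\<close>.\<close>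

fun concat_below :: "('x \<Rightarrow> 'x \<Rightarrow> 'x) \<Rightarrow> (nat \<Rightarrow> 'x) \<Rightarrow> nat \<Rightarrow> 'x" where
  "concat_below op X 0 = undefined"
| "concat_below op X (Suc 0) = X 0"
| "concat_below op X (Suc (Suc n)) = op (concat_below op X (Suc n)) (X (Suc n))"


section \<open>Deconstruction\<close>

datatype 'j dvert = RVert 'j nat | SVert 'j nat

datatype ('j, 'a) dedge = FEdge 'j nat | BEdge 'j nat | SEdge 'a nat | REdge 'a nat

text \<open>
  \<open>SEdge \<sigma> i\<close> runs from \<open>(j, s\<^sub>i)\<close> covariantly in \<open>\<sigma> : j \<rightarrow> j'\<close>;
  \<open>REdge \<sigma> i\<close> runs from \<open>(j', r\<^sub>i)\<close> contravariantly.
\<close>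

definition deconstruction ::
  "('o, 'm) cat \<Rightarrow> ('j, 'a) cat \<Rightarrow> ('j, 'a, ('o, 'm) zigzag, ('o, 'm) zmap) ftor \<Rightarrow>
     ('j dvert, ('j, 'a) dedge, 'o, 'm) diagram" where
  "deconstruction C J E =
     \<lparr>Verts = {RVert j i | j i. j \<in> Obj J \<and> i \<le> zlen (FObj E j)} \<union>
              {SVert j i | j i. j \<in> Obj J \<and> i < zlen (FObj E j)},
      Edges = {FEdge j i | j i. j \<in> Obj J \<and> i < zlen (FObj E j)} \<union>
              {BEdge j i | j i. j \<in> Obj J \<and> i < zlen (FObj E j)} \<union>
              {SEdge \<sigma> i | \<sigma> i. \<sigma> \<in> Arr J \<and> i < zlen (FObj E (Dom J \<sigma>))} \<union>
              {REdge \<sigma> i | \<sigma> i. \<sigma> \<in> Arr J \<and> i \<le> zlen (FObj E (Cod J \<sigma>))},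
      Src = (\<lambda>e. case e of
               FEdge j i \<Rightarrow> RVert j i
             | BEdge j i \<Rightarrow> RVert j (i + 1)
             | SEdge \<sigma> i \<Rightarrow> SVert (Dom J \<sigma>) i
             | REdge \<sigma> i \<Rightarrow> RVert (Cod J \<sigma>) i),
      Tgt = (\<lambda>e. case e of
               FEdge j i \<Rightarrow> SVert j i
             | BEdge j i \<Rightarrow> SVert j i
             | SEdge \<sigma> i \<Rightarrow> SVert (Cod J \<sigma>) (vals (zsing (FArr E \<sigma>)) ! i)
             | REdge \<sigma> i \<Rightarrow> RVert (Dom J \<sigma>) (zreg (FArr E \<sigma>) i)),
      VLab = (\<lambda>v. case v of
               RVert j i \<Rightarrow> robj (FObj E j) ! i
             | SVert j i \<Rightarrow> sobj (FObj E j) ! i),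
      ELab = (\<lambda>e. case e of
               FEdge j i \<Rightarrow> fwd (FObj E j) ! i
             | BEdge j i \<Rightarrow> bwd (FObj E j) ! i
             | SEdge \<sigma> i \<Rightarrow> zcomp (FArr E \<sigma>) ! i
             | REdge \<sigma> i \<Rightarrow> Ident C (robj (FObj E (Cod J \<sigma>)) ! i))\<rparr>"


section \<open>The colimit procedure\<close>

text \<open>The diagram \<open>D\<^sub>k\<close>, for a cocone \<open>cs\<close> of monotone maps \<open>cs j : D(j)\<^sub>s\<^sub>i\<^sub>n\<^sub>g \<rightarrow> [c]\<close> and \<open>k < c\<close>.\<close>

definition piece ::
  "('j, 'a) cat \<Rightarrow> ('j, 'a, ('o, 'm) zigzag, ('o, 'm) zmap) ftor \<Rightarrow> ('j \<Rightarrow> mono_map) \<Rightarrow> nat \<Rightarrow>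
     ('j, 'a, ('o, 'm) zigzag, ('o, 'm) zmap) ftor" where
  "piece J D cs k =
     \<lparr>FObj = \<lambda>j. zrestrict (FObj D j) (dual (cs j) k) (dual (cs j) (k + 1)),
      FArr = \<lambda>\<sigma>. zmap_restrict (FArr D \<sigma>) (dual (cs (Cod J \<sigma>)) k) (dual (cs (Cod J \<sigma>)) (k + 1))\<rparr>"

text \<open>
  The zigzag \<open>C\<^sub>k\<close> obtained from a cocone \<open>(p, \<phi>)\<close> on the deconstruction of \<open>E = D\<^sub>k\<close>, where \<open>j\<close> is
  the object, with \<open>E(j)\<close> of positive length, that is used to define the two morphisms.
\<close>

definition block ::
  "('o, 'm) cat \<Rightarrow> ('j, 'a, ('o, 'm) zigzag, ('o, 'm) zmap) ftor \<Rightarrow> 'o \<Rightarrow> ('j dvert \<Rightarrow> 'm) \<Rightarrow> 'j \<Rightarrow>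
     ('o, 'm) zigzag" where
  "block C E p \<phi> j =
     (let m = zlen (FObj E j);
          f = Comp C (\<phi> (SVert j 0)) (fwd (FObj E j) ! 0);
          b = Comp C (\<phi> (SVert j (m - 1))) (bwd (FObj E j) ! (m - 1))
      in \<lparr>robj = [Dom C f, Dom C b], sobj = [p], fwd = [f], bwd = [b]\<rparr>)"

definition block_leg ::
  "('j, 'a, ('o, 'm) zigzag, ('o, 'm) zmap) ftor \<Rightarrow> ('o, 'm) zigzag \<Rightarrow> ('j dvert \<Rightarrow> 'm) \<Rightarrow> 'j \<Rightarrow>
     ('o, 'm) zmap" where
  "block_leg E B \<phi> j =
     (let m = zlen (FObj E j)
      in \<lparr>zdom = FObj E j, zcod = B, zsing = \<lparr>vals = replicate m 0, mcod = 1\<rparr>,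
          zcomp = map (\<lambda>i. \<phi> (SVert j i)) [0..<m]\<rparr>)"

text \<open>
  The output of the procedure, given the chosen colimit \<open>(c, cs)\<close> of the singular
  parts, the chosen colimits \<open>(p k, \<phi> k)\<close> for \<open>k < c\<close>, the objects \<open>w k\<close> used to define the
  blocks, and an object \<open>j\<^sub>0\<close> that matters only for \<open>c = 0\<close>.
\<close>

definition proc_apex ::
  "('o, 'm) cat \<Rightarrow> ('j, 'a) cat \<Rightarrow> ('j, 'a, ('o, 'm) zigzag, ('o, 'm) zmap) ftor \<Rightarrow>
     nat \<Rightarrow> ('j \<Rightarrow> mono_map) \<Rightarrow> (nat \<Rightarrow> 'o) \<Rightarrow> (nat \<Rightarrow> 'j dvert \<Rightarrow> 'm) \<Rightarrow> (nat \<Rightarrow> 'j) \<Rightarrow> 'j \<Rightarrow>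
     ('o, 'm) zigzag" where
  "proc_apex C J D c cs p \<phi> w j\<^sub>0 =
     (if c = 0 then FObj D j\<^sub>0
      else concat_below zconcat (\<lambda>k. block C (piece J D cs k) (p k) (\<phi> k) (w k)) c)"

definition proc_leg ::
  "('o, 'm) cat \<Rightarrow> ('j, 'a) cat \<Rightarrow> ('j, 'a, ('o, 'm) zigzag, ('o, 'm) zmap) ftor \<Rightarrow>
     nat \<Rightarrow> ('j \<Rightarrow> mono_map) \<Rightarrow> (nat \<Rightarrow> 'o) \<Rightarrow> (nat \<Rightarrow> 'j dvert \<Rightarrow> 'm) \<Rightarrow> (nat \<Rightarrow> 'j) \<Rightarrow> 'j \<Rightarrow>
     ('o, 'm) zmap" where
  "proc_leg C J D c cs p \<phi> w j =
     (if c = 0 then zid C (FObj D j)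
      else concat_below zmap_concat
             (\<lambda>k. block_leg (piece J D cs k) (block C (piece J D cs k) (p k) (\<phi> k) (w k)) (\<phi> k) j) c)"

end

theory Submission
  imports Defs
begin

text \<open>
  The idea is that zigzag maps, cocones and mediating maps can all be cut along regular objects.

  Apart from the equations between regular objects, a zigzag map \<open>g : Z \<rightarrow> Z'\<close> consists of a monotone
  map and, for each singular object \<open>s\<^sub>l\<close> of \<open>Z'\<close>, a cocone with apex \<open>s\<^sub>l\<close> on the part of \<open>Z\<close> lying
  over \<open>s\<^sub>l\<close>, whose first and last legs are the forward and the backward map into \<open>s\<^sub>l\<close> (\<open>reg_arrow\<close>, \<open>is_zmapI\<close>).  Consequently a cocone over \<open>D\<close>
  with apex \<open>A\<close> is a cocone of monotone maps together with, for each singular object of \<open>A\<close>, a cocone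
  on the deconstruction of the corresponding piece of \<open>D\<close> (\<open>sliced_cocone_is_cocone\<close>,
  \<open>cocone_sliced\<close>).  Any family of cocones on the pieces can be glued (\<open>glued_sliced\<close>): by
  connectedness of the index category the outermost legs of a piece do not depend on the index, so
  that they can serve as the forward and backward maps of the apex.  Mediating maps between glued
  cocones are a monotone map together with a morphism for each piece (\<open>mediating_zmap\<close>,
  \<open>mediating_zmapD\<close>).

  Hence a colimit of the monotone parts and colimits of all pieces glue to a colimit
  (\<open>sliced_colimit\<close>).  For the converse (\<open>colimit_slices\<close>) the universal property of a given
  colimit \<open>A\<close> is tested on glued cocones in which all pieces, or all but one, have the terminal object
  as apex.  With terminal objects everywhere, every cocone of monotone maps lifts, and uniquely
  so do the maps out of \<open>A\<close>; hence the monotone part of \<open>A\<close> is a colimit.  With an arbitrary cocone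
  at one piece, mediating maps are morphisms out of the singular object of \<open>A\<close> at that piece.

  One asymmetry needs care: an index whose part in a piece is a single regular object has no singular
  vertex there.  The legs of a colimit of monotone maps are jointly surjective
  (\<open>sing_colimit_surj\<close>), so some other index has one, and connectedness transports the
  information (\<open>reg_compat_if_sing_compat\<close>).

  Finally, the concatenation that the procedure forms is the glued zigzag (\<open>proc_apex_eq\<close>,
  \<open>proc_leg_eq\<close>).
\<close>


section \<open>Preliminaries\<close>

lemma unique_eq: "\<exists>!x. P x \<Longrightarrow> P a \<Longrightarrow> P b \<Longrightarrow> a = b"
  by blast

lemma slice_nth: "b \<le> length xs \<Longrightarrow> i < b - a \<Longrightarrow> slice a b xs ! i = xs ! (a + i)"
  by (simp add: slice_def)

lemma length_slice: "b \<le> length xs \<Longrightarrow> length (slice a b xs) = b - a"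
  by (simp add: slice_def)

lemma slice_append:
  assumes "a \<le> b" "b \<le> c"
  shows "slice a b xs @ slice b c xs = slice a c xs"
proof -
  have "take (b - a + (c - b)) (drop a xs) = slice a b xs @ slice b c xs"
    unfolding take_add slice_def using assms by simp
  then show ?thesis using assms by (simp add: slice_def)
qed

lemma all_less_shift: "(\<forall>i<b - a. P (a + i)) \<longleftrightarrow> (\<forall>i. a \<le> i \<and> i < b \<longrightarrow> P i)" for a b :: nat
proof (intro iffI allI impI)
  fix i assume "\<forall>i<b - a. P (a + i)" and i: "a \<le> i \<and> i < b"
  then have "P (a + (i - a))" by (blast intro: diff_less_mono)
  then show "P i" using i by simp
next
  fix i assume "\<forall>i. a \<le> i \<and> i < b \<longrightarrow> P i" and "i < b - a"
  then show "P (a + i)" by simp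
qed

lemma all_le_shift: "a \<le> b \<Longrightarrow> (\<forall>i\<le>b - a. P (a + i)) \<longleftrightarrow> (\<forall>i. a \<le> i \<and> i \<le> b \<longrightarrow> P i)" for a b :: nat
  using all_less_shift[of "Suc b" a P] by (simp add: Suc_diff_le less_Suc_eq_le)

lemma (in category) Hom_comp_ident:
  assumes "f \<in> Hom C x y"
  shows "Comp C f (Ident C x) = f" "Comp C (Ident C y) f = f"
  using comp_ident_right[of f] comp_ident_left[of f] assms unfolding Hom_def by auto


section \<open>Monotone maps and their duals\<close>

lemma Hom_Delta_iff:
  "h \<in> Hom Delta n m \<longleftrightarrow> is_mono_map h \<and> mdom h = n \<and> mcod h = m"
  by (auto simp: Hom_def Delta_def)

lemma Comp_Delta [simp]: "Comp Delta = mono_comp"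
  by (simp add: Delta_def)

lemma mdom_mono_comp [simp]: "mdom (mono_comp g h) = mdom h"
  by (simp add: mdom_def mono_comp_def)

lemma mcod_mono_comp [simp]: "mcod (mono_comp g h) = mcod g"
  by (simp add: mono_comp_def)

lemma vals_mono_comp [simp]:
  "i < mdom h \<Longrightarrow> vals (mono_comp g h) ! i = vals g ! (vals h ! i)"
  by (simp add: mdom_def mono_comp_def)

lemma mono_map_eqI:
  fixes g h :: mono_map
  assumes "mdom g = mdom h" "mcod g = mcod h" "\<And>i. i < mdom h \<Longrightarrow> vals g ! i = vals h ! i"
  shows "g = h"
proof -
  have "vals g = vals h"
    using assms by (intro nth_equalityI) (auto simp: mdom_def)
  then show ?thesis using assms(2) by simp
qed

lemma vals_mono: "is_mono_map h \<Longrightarrow> i \<le> i' \<Longrightarrow> i' < mdom h \<Longrightarrow> vals h ! i \<le> vals h ! i'"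
  by (simp add: is_mono_map_def mdom_def sorted_nth_mono)

lemma vals_less_mcod: "is_mono_map h \<Longrightarrow> i < mdom h \<Longrightarrow> vals h ! i < mcod h"
  by (simp add: is_mono_map_def)

lemma is_mono_mapI:
  assumes "\<And>i i'. i \<le> i' \<Longrightarrow> i' < mdom h \<Longrightarrow> vals h ! i \<le> vals h ! i'"
    and "\<And>i. i < mdom h \<Longrightarrow> vals h ! i < mcod h"
  shows "is_mono_map h"
  using assms by (auto simp: is_mono_map_def mdom_def sorted_iff_nth_mono)

lemma is_mono_map_comp:
  assumes "is_mono_map g" "is_mono_map h" "mcod h = mdom g"
  shows "is_mono_map (mono_comp g h)"
  using assms by (intro is_mono_mapI) (auto intro!: vals_mono vals_less_mcod dest: vals_less_mcod)

lemma mono_comp_assoc: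
  assumes "is_mono_map h" "mcod h = mdom g"
  shows "mono_comp (mono_comp u g) h = mono_comp u (mono_comp g h)"
  using assms by (intro mono_map_eqI) (auto dest: vals_less_mcod)

lemma dual_le_mdom: "dual h j \<le> mdom h"
  unfolding dual_def by (rule Min_le) auto

text \<open>The dual is left adjoint to \<open>h\<close> extended by top to top.  An index at most \<open>mdom h\<close> is determined by
  its upper bounds below \<open>mdom h\<close>, so equations between duals can be read off from this
  equivalence.\<close>

lemma dual_le_iff:
  assumes "is_mono_map h" "i < mdom h"
  shows "dual h j \<le> i \<longleftrightarrow> j \<le> vals h ! i"
proof -
  let ?A = "{i. i \<le> mdom h \<and> (i = mdom h \<or> vals h ! i \<ge> j)}"
  have fin: "finite ?A" by auto
  have "?A \<noteq> {}" by auto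
  then have mem: "dual h j \<in> ?A" unfolding dual_def using Min_in[OF fin] by blast
  show ?thesis
  proof
    assume "dual h j \<le> i"
    with mem assms vals_mono[of h "dual h j" i] show "j \<le> vals h ! i" by auto
  next
    assume "j \<le> vals h ! i"
    with assms show "dual h j \<le> i" unfolding dual_def by (intro Min_le[OF fin]) auto
  qed
qed

lemma dual_eqI:
  assumes "is_mono_map h" "x \<le> mdom h" "\<And>i. i < mdom h \<Longrightarrow> x \<le> i \<longleftrightarrow> j \<le> vals h ! i"
  shows "dual h j = x"
proof -
  have iff: "dual h j \<le> i \<longleftrightarrow> x \<le> i" if "i < mdom h" for i
    using dual_le_iff[OF assms(1) that] assms(3)[OF that] by simp
  show ?thesis
    using iff[of x] iff[of "dual h j"] dual_le_mdom[of h j] assms(2) by linarith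
qed

lemma dual_mono:
  assumes "is_mono_map h" "j \<le> j'"
  shows "dual h j \<le> dual h j'"
proof (cases "dual h j' < mdom h")
  case True
  then show ?thesis
    using dual_le_iff[OF assms(1) True] assms(2) by (meson le_trans order_refl)
next
  case False
  then show ?thesis using dual_le_mdom[of h j] by linarith
qed

lemma dual_0: "is_mono_map h \<Longrightarrow> dual h 0 = 0"
  by (rule dual_eqI) auto

lemma dual_mcod: "is_mono_map h \<Longrightarrow> dual h (mcod h) = mdom h"
  by (rule dual_eqI) (auto dest: vals_less_mcod)

lemma dual_mono_comp:
  assumes "is_mono_map g" "is_mono_map h" "mcod h = mdom g"
  shows "dual (mono_comp g h) j = dual h (dual g j)"
proof (rule dual_eqI)
  show "is_mono_map (mono_comp g h)" using assms by (rule is_mono_map_comp)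
  show "dual h (dual g j) \<le> mdom (mono_comp g h)" by (simp add: dual_le_mdom)
next
  fix i assume "i < mdom (mono_comp g h)"
  then show "dual h (dual g j) \<le> i \<longleftrightarrow> j \<le> vals (mono_comp g h) ! i"
    using assms vals_less_mcod[OF assms(2), of i] by (simp add: dual_le_iff)
qed

lemma fibre_iff:
  assumes "is_mono_map h" "i < mdom h"
  shows "vals h ! i = l \<longleftrightarrow> dual h l \<le> i \<and> i < dual h (Suc l)"
  using dual_le_iff[OF assms, of l] dual_le_iff[OF assms, of "Suc l"] by linarith

lemma fibre_eq_interval:
  assumes "is_mono_map h"
  shows "{i. i < mdom h \<and> vals h ! i = l} = {dual h l..<dual h (Suc l)}"
proof (rule set_eqI)
  fix i
  show "i \<in> {i. i < mdom h \<and> vals h ! i = l} \<longleftrightarrow> i \<in> {dual h l..<dual h (Suc l)}"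
  proof (cases "i < mdom h")
    case True
    then show ?thesis using fibre_iff[OF assms True, of l] by simp
  next
    case False
    then show ?thesis using dual_le_mdom[of h "Suc l"] by simp
  qed
qed

lemma Ident_Delta_simps:
  "is_mono_map (Ident Delta n)" "mdom (Ident Delta n) = n" "mcod (Ident Delta n) = n"
  "i < n \<Longrightarrow> vals (Ident Delta n) ! i = i"
  by (auto simp: Delta_def mdom_def intro!: is_mono_mapI)

lemma Ident_Delta_comp: "is_mono_map h \<Longrightarrow> mono_comp (Ident Delta (mcod h)) h = h"
  by (rule mono_map_eqI) (auto simp: Ident_Delta_simps vals_less_mcod)


section \<open>Zigzag maps as extensions along regular objects\<close>

lemma zigzag_simps:
  assumes "is_zigzag C Z"
  shows "length (robj Z) = Suc (zlen Z)" "length (sobj Z) = zlen Z"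
    "length (fwd Z) = zlen Z" "length (bwd Z) = zlen Z"
    "\<And>i. i \<le> zlen Z \<Longrightarrow> robj Z ! i \<in> Obj C"
    "\<And>i. i < zlen Z \<Longrightarrow> sobj Z ! i \<in> Obj C"
    "\<And>i. i < zlen Z \<Longrightarrow> fwd Z ! i \<in> Hom C (robj Z ! i) (sobj Z ! i)"
    "\<And>i. i < zlen Z \<Longrightarrow> bwd Z ! i \<in> Hom C (robj Z ! Suc i) (sobj Z ! i)"
  using assms unfolding is_zigzag_def zlen_def by (auto simp: subset_iff)

text \<open>The leg \<open>r\<^sub>i \<rightarrow> s\<^sub>l\<close> at the \<open>i\<close>-th regular object of the domain of the cocone that \<open>g\<close> cuts out over
  the \<open>l\<close>-th singular object of the codomain; meaningful for \<open>i\<close> between \<open>zreg g l\<close> and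
  \<open>zreg g (Suc l)\<close>.  The second case covers the last regular object, also when the fibre is empty.\<close>

definition reg_arrow :: "('o, 'm) cat \<Rightarrow> ('o, 'm) zmap \<Rightarrow> nat \<Rightarrow> nat \<Rightarrow> 'm" where
  "reg_arrow C g l i =
     (if i < zreg g (Suc l) then Comp C (zcomp g ! i) (fwd (zdom g) ! i) else bwd (zcod g) ! l)"

lemma zmap_simps:
  assumes "is_zmap C g"
  shows "is_zigzag C (zdom g)" "is_zigzag C (zcod g)"
    "is_mono_map (zsing g)" "mdom (zsing g) = zlen (zdom g)" "mcod (zsing g) = zlen (zcod g)"
    "length (zcomp g) = zlen (zdom g)"
    "\<And>i. i < zlen (zdom g) \<Longrightarrow>
       zcomp g ! i \<in> Hom C (sobj (zdom g) ! i) (sobj (zcod g) ! (vals (zsing g) ! i))"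
    "\<And>l. l \<le> zlen (zcod g) \<Longrightarrow> robj (zcod g) ! l = robj (zdom g) ! zreg g l"
proof -
  note * = assms[unfolded is_zmap_def Let_def Hom_Delta_iff]
  show "is_zigzag C (zdom g)" "is_zigzag C (zcod g)"
    "is_mono_map (zsing g)" "mdom (zsing g) = zlen (zdom g)" "mcod (zsing g) = zlen (zcod g)"
    "length (zcomp g) = zlen (zdom g)"
    using * by simp_all
  show "zcomp g ! i \<in> Hom C (sobj (zdom g) ! i) (sobj (zcod g) ! (vals (zsing g) ! i))"
    if "i < zlen (zdom g)" for i using * that by simp
  show "robj (zcod g) ! l = robj (zdom g) ! zreg g l" if "l \<le> zlen (zcod g)" for l
    using * that by simp
qed

lemma
  assumes g: "is_zmap C g" and l: "l < zlen (zcod g)"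
  shows reg_arrow_first: "reg_arrow C g l (zreg g l) = fwd (zcod g) ! l"
    and reg_arrow_last: "reg_arrow C g l (zreg g (Suc l)) = bwd (zcod g) ! l"
    and reg_arrow_fwd: "i < zlen (zdom g) \<Longrightarrow> vals (zsing g) ! i = l \<Longrightarrow>
      Comp C (zcomp g ! i) (fwd (zdom g) ! i) = reg_arrow C g l i"
    and reg_arrow_bwd: "i < zlen (zdom g) \<Longrightarrow> vals (zsing g) ! i = l \<Longrightarrow>
      Comp C (zcomp g ! i) (bwd (zdom g) ! i) = reg_arrow C g l (Suc i)"
proof -
  note h = zmap_simps(3-5)[OF g]
  define a b where "a = zreg g l" and "b = zreg g (Suc l)"
  have ab: "a \<le> b" "b \<le> zlen (zdom g)"
    using dual_mono[OF h(1), of l "Suc l"] dual_le_mdom[of "zsing g" "Suc l"] h(2)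
    unfolding a_def b_def zreg_def by auto
  have fib: "{i. i < zlen (zdom g) \<and> vals (zsing g) ! i = l} = {a..<b}"
    using fibre_eq_interval[OF h(1)] h(2) unfolding a_def b_def zreg_def by simp
  have mn: "a < b \<Longrightarrow> Min {a..<b} = a"
    by (rule Min_eqI) auto
  have mx: "a < b \<Longrightarrow> Max {a..<b} = b - 1"
    by (rule Max_eqI) auto
  let ?P = "{i. i < zlen (zdom g) \<and> vals (zsing g) ! i = l}"
  have P: "(?P = {} \<longrightarrow> fwd (zcod g) ! l = bwd (zcod g) ! l) \<and>
      (?P \<noteq> {} \<longrightarrow>
         fwd (zcod g) ! l = Comp C (zcomp g ! Min ?P) (fwd (zdom g) ! Min ?P) \<and>
         bwd (zcod g) ! l = Comp C (zcomp g ! Max ?P) (bwd (zdom g) ! Max ?P) \<and>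
         (\<forall>i. Min ?P \<le> i \<and> i < Max ?P \<longrightarrow>
            Comp C (zcomp g ! i) (bwd (zdom g) ! i) =
            Comp C (zcomp g ! (i + 1)) (fwd (zdom g) ! (i + 1))))"
    using g l unfolding is_zmap_def Let_def by blast
  have emp: "fwd (zcod g) ! l = bwd (zcod g) ! l" if "\<not> a < b"
  proof -
    have "{a..<b} = {}" using that by simp
    with P[unfolded fib] show ?thesis by blast
  qed
  have ne: "fwd (zcod g) ! l = Comp C (zcomp g ! a) (fwd (zdom g) ! a)"
    "bwd (zcod g) ! l = Comp C (zcomp g ! (b - 1)) (bwd (zdom g) ! (b - 1))"
    "\<And>i. a \<le> i \<Longrightarrow> i < b - 1 \<Longrightarrow>
      Comp C (zcomp g ! i) (bwd (zdom g) ! i) = Comp C (zcomp g ! (i + 1)) (fwd (zdom g) ! (i + 1))"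
    if "a < b"
  proof -
    have "{a..<b} \<noteq> {}" using that by simp
    note Q = mp[OF conjunct2[OF P[unfolded fib mn[OF that] mx[OF that]]] this]
    show "fwd (zcod g) ! l = Comp C (zcomp g ! a) (fwd (zdom g) ! a)"
      "bwd (zcod g) ! l = Comp C (zcomp g ! (b - 1)) (bwd (zdom g) ! (b - 1))"
      "\<And>i. a \<le> i \<Longrightarrow> i < b - 1 \<Longrightarrow>
        Comp C (zcomp g ! i) (bwd (zdom g) ! i) =
        Comp C (zcomp g ! (i + 1)) (fwd (zdom g) ! (i + 1))"
      using Q by blast+
  qed
  show "reg_arrow C g l (zreg g l) = fwd (zcod g) ! l"
  proof (cases "a < b")
    case True
    then show ?thesis using ne(1) by (simp add: reg_arrow_def a_def b_def)
  next
    case False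
    then show ?thesis using emp by (simp add: reg_arrow_def a_def b_def)
  qed
  show "reg_arrow C g l (zreg g (Suc l)) = bwd (zcod g) ! l"
    unfolding reg_arrow_def by simp
  assume i: "i < zlen (zdom g)" "vals (zsing g) ! i = l"
  then have "i \<in> ?P" by simp
  then have iab: "a \<le> i" "i < b" unfolding fib by auto
  show "Comp C (zcomp g ! i) (fwd (zdom g) ! i) = reg_arrow C g l i"
    using iab by (simp add: reg_arrow_def b_def)
  show "Comp C (zcomp g ! i) (bwd (zdom g) ! i) = reg_arrow C g l (Suc i)"
  proof (cases "Suc i < b")
    case True
    then have "a < b" "i < b - 1" using iab by linarith+
    then show ?thesis using True ne(3)[OF _ iab(1)] by (simp add: reg_arrow_def b_def)
  next
    case False
    then have "a < b" "b - 1 = i" using iab by linarith+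
    then show ?thesis using ne(2) False by (simp add: reg_arrow_def b_def)
  qed
qed

text \<open>The equations for empty fibres, for the ends of a fibre and for its interior say together that
  all legs at regular objects form one well-defined family \<open>R\<close> ending in the forward and the backward
  map.  Exhibiting \<open>R\<close> avoids the case distinction.\<close>

lemma is_zmapI:
  assumes zz: "is_zigzag C (zdom g)" "is_zigzag C (zcod g)"
    and h: "is_mono_map (zsing g)" "mdom (zsing g) = zlen (zdom g)" "mcod (zsing g) = zlen (zcod g)"
    and len: "length (zcomp g) = zlen (zdom g)"
    and comp: "\<And>i. i < zlen (zdom g) \<Longrightarrow>
       zcomp g ! i \<in> Hom C (sobj (zdom g) ! i) (sobj (zcod g) ! (vals (zsing g) ! i))"
    and reg: "\<And>l. l \<le> zlen (zcod g) \<Longrightarrow> robj (zcod g) ! l = robj (zdom g) ! zreg g l"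
    and first: "\<And>l. l < zlen (zcod g) \<Longrightarrow> R l (zreg g l) = fwd (zcod g) ! l"
    and last: "\<And>l. l < zlen (zcod g) \<Longrightarrow> R l (zreg g (Suc l)) = bwd (zcod g) ! l"
    and fwd: "\<And>l i. l < zlen (zcod g) \<Longrightarrow> i < zlen (zdom g) \<Longrightarrow> vals (zsing g) ! i = l \<Longrightarrow>
       Comp C (zcomp g ! i) (fwd (zdom g) ! i) = R l i"
    and bwd: "\<And>l i. l < zlen (zcod g) \<Longrightarrow> i < zlen (zdom g) \<Longrightarrow> vals (zsing g) ! i = l \<Longrightarrow>
       Comp C (zcomp g ! i) (bwd (zdom g) ! i) = R l (Suc i)"
  shows "is_zmap C g"
  unfolding is_zmap_def Let_def
proof (intro conjI allI impI)
  show "is_zigzag C (zdom g)" "is_zigzag C (zcod g)" by fact+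
  show "zsing g \<in> Hom Delta (zlen (zdom g)) (zlen (zcod g))"
    using h by (simp add: Hom_Delta_iff)
  show "length (zcomp g) = zlen (zdom g)" by fact
  show "zcomp g ! i \<in> Hom C (sobj (zdom g) ! i) (sobj (zcod g) ! (vals (zsing g) ! i))"
    if "i < zlen (zdom g)" for i using that by (rule comp)
  show "robj (zcod g) ! j = robj (zdom g) ! zreg g j" if "j \<le> zlen (zcod g)" for j
    using that by (rule reg)
next
  fix l assume l: "l < zlen (zcod g)"
  let ?P = "{i. i < zlen (zdom g) \<and> vals (zsing g) ! i = l}"
  define a b where "a = zreg g l" and "b = zreg g (Suc l)"
  have ab: "a \<le> b" "b \<le> zlen (zdom g)"
    using dual_mono[OF h(1), of l "Suc l"] dual_le_mdom[of "zsing g" "Suc l"] h(2)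
    unfolding a_def b_def zreg_def by auto
  have fib: "?P = {a..<b}"
    using fibre_eq_interval[OF h(1)] h(2) unfolding a_def b_def zreg_def by simp
  have mem: "i < zlen (zdom g) \<and> vals (zsing g) ! i = l" if "a \<le> i" "i < b" for i
  proof -
    have "i \<in> {a..<b}" using that by simp
    then have "i \<in> ?P" unfolding fib .
    then show ?thesis by simp
  qed
  show "fwd (zcod g) ! l = bwd (zcod g) ! l" if "?P = {}"
  proof -
    have "a = b" using that ab unfolding fib by simp
    then show ?thesis using first[OF l] last[OF l] by (simp add: a_def b_def)
  qed
  assume "?P \<noteq> {}"
  then have lt: "a < b" unfolding fib by simp
  have mn: "Min ?P = a" unfolding fib by (rule Min_eqI) (use lt in auto)
  have mx: "Max ?P = b - 1" unfolding fib by (rule Max_eqI) (use lt in auto)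
  show "fwd (zcod g) ! l = Comp C (zcomp g ! Min ?P) (fwd (zdom g) ! Min ?P)"
    unfolding mn using first[OF l] fwd[OF l, of a] mem[of a] lt by (simp add: a_def)
  show "bwd (zcod g) ! l = Comp C (zcomp g ! Max ?P) (bwd (zdom g) ! Max ?P)"
    unfolding mx using last[OF l] bwd[OF l, of "b - 1"] mem[of "b - 1"] lt by (simp add: b_def)
  fix i assume i: "Min ?P \<le> i \<and> i < Max ?P"
  then have "a \<le> i" "i < b" "a \<le> Suc i" "Suc i < b" unfolding mn mx by auto
  then show "Comp C (zcomp g ! i) (bwd (zdom g) ! i) =
      Comp C (zcomp g ! (i + 1)) (fwd (zdom g) ! (i + 1))"
    using bwd[OF l, of i] fwd[OF l, of "Suc i"] mem by simp
qed

lemma zmap_eqI: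
  assumes "is_zmap C g" "is_zmap C g'" "zdom g = zdom g'" "zcod g = zcod g'" "zsing g = zsing g'"
    "\<And>k. k < zlen (zdom g) \<Longrightarrow> zcomp g ! k = zcomp g' ! k"
  shows "g = g'"
proof -
  have "zcomp g = zcomp g'"
    using zmap_simps(6)[OF assms(1)] zmap_simps(6)[OF assms(2)] assms(3,6)
    by (intro nth_equalityI) auto
  then show ?thesis using assms by simp
qed

lemma (in category) reg_arrow_hom:
  assumes g: "is_zmap C g" and l: "l < zlen (zcod g)"
    and i: "zreg g l \<le> i" "i \<le> zreg g (Suc l)"
  shows "reg_arrow C g l i \<in> Hom C (robj (zdom g) ! i) (sobj (zcod g) ! l)"
proof (cases "i < zreg g (Suc l)")
  case True
  note h = zmap_simps(3-5)[OF g]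
  have "i < zlen (zdom g)"
    using True dual_le_mdom[of "zsing g" "Suc l"] h(2) by (auto simp: zreg_def)
  moreover from this have "vals (zsing g) ! i = l"
    using fibre_iff[OF h(1)] h(2) i True by (simp add: zreg_def)
  ultimately show ?thesis
    using True comp_hom zmap_simps(7)[OF g, of i] zigzag_simps(7)[OF zmap_simps(1)[OF g], of i]
    by (auto simp: reg_arrow_def)
next
  case False
  then have "i = zreg g (Suc l)" using i by simp
  then show ?thesis
    using False zigzag_simps(8)[OF zmap_simps(2)[OF g] l] zmap_simps(8)[OF g, of "Suc l"] l
    by (simp add: reg_arrow_def)
qed

text \<open>Going down from the last regular object, each step crosses
  one singular object \<open>i\<close> of the middle zigzag: either its fibre under \<open>f\<close> is empty and nothing
  changes, or the first index of the fibre lies over \<open>i\<close> itself.\<close>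

lemma (in category) reg_arrow_comp:
  assumes f: "is_zmap C f" and g: "is_zmap C g" and eq: "zcod f = zdom g"
    and gf: "is_zmap C (zmap_comp C g f)" and l: "l < zlen (zcod g)"
    and i: "zreg g l \<le> i" "i \<le> zreg g (Suc l)"
  shows "reg_arrow C (zmap_comp C g f) l (zreg f i) = reg_arrow C g l i"
  using i(2) i(1)
proof (induction rule: inc_induct)
  note hf = zmap_simps(3-5)[OF f] and hg = zmap_simps(3-5)[OF g]
  have reg: "zreg (zmap_comp C g f) j = zreg f (zreg g j)" for j
    using dual_mono_comp[OF hg(1) hf(1)] hf(3) hg(2) eq
    by (simp add: zreg_def zmap_comp_def)
  {
    case base
    show ?case
      unfolding reg[symmetric] using reg_arrow_last[OF gf] reg_arrow_last[OF g l] l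
      by (simp add: zmap_comp_def)
  next
    case (step n)
    have n: "n < zlen (zdom g)" "n < zlen (zcod f)"
      using step(2) dual_le_mdom[of "zsing g" "Suc l"] hg(2) eq by (auto simp: zreg_def)
    have gn: "vals (zsing g) ! n = l"
      using fibre_iff[OF hg(1)] hg(2) n step by (simp add: zreg_def)
    show ?case
    proof (cases "zreg f n = zreg f (Suc n)")
      case True
      have "fwd (zdom g) ! n = bwd (zdom g) ! n"
        using reg_arrow_first[OF f n(2)] reg_arrow_last[OF f n(2)] True eq by simp
      then have "reg_arrow C g l n = reg_arrow C g l (Suc n)"
        using reg_arrow_fwd[OF g l n(1) gn] reg_arrow_bwd[OF g l n(1) gn] by simp
      then show ?thesis using step.IH step.hyps step.prems True by (metis le_SucI)
    next
      case False
      define m where "m = zreg f n"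
      have m: "m < zreg f (Suc n)"
        using False dual_mono[OF hf(1), of n "Suc n"] by (simp add: zreg_def m_def)
      then have md: "m < zlen (zdom f)"
        using dual_le_mdom[of "zsing f" "Suc n"] hf(2) by (simp add: zreg_def)
      then have fm: "vals (zsing f) ! m = n"
        using fibre_iff[OF hf(1)] hf(2) m by (simp add: zreg_def m_def)
      have cf: "vals (zsing (zmap_comp C g f)) ! m = l"
        using fm gn md hf(2) by (simp add: zmap_comp_def)
      have "reg_arrow C (zmap_comp C g f) l m =
          Comp C (Comp C (zcomp g ! n) (zcomp f ! m)) (fwd (zdom f) ! m)"
        using reg_arrow_fwd[OF gf _ _ cf] md fm l by (simp add: zmap_comp_def)
      also have "\<dots> = Comp C (zcomp g ! n) (Comp C (zcomp f ! m) (fwd (zdom f) ! m))"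
        using comp_assoc[OF zigzag_simps(7)[OF zmap_simps(1)[OF f] md] zmap_simps(7)[OF f md]]
          zmap_simps(7)[OF g n(1)] fm eq by simp
      also have "Comp C (zcomp f ! m) (fwd (zdom f) ! m) = fwd (zdom g) ! n"
        using reg_arrow_fwd[OF f n(2) md fm] reg_arrow_first[OF f n(2)] eq by (simp add: m_def)
      also have "Comp C (zcomp g ! n) (fwd (zdom g) ! n) = reg_arrow C g l n"
        using reg_arrow_fwd[OF g l n(1) gn] .
      finally show ?thesis by (simp add: m_def)
    qed
  }
qed

section \<open>Cocones over a diagram of zigzags, one singular object at a time\<close>

locale zigzag_diagram = category C + J: category J
  for C :: "('o, 'm) cat" and J :: "('j, 'a) cat" +
  fixes D :: "('j, 'a, ('o, 'm) zigzag, ('o, 'm) zmap) ftor"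
  assumes conn: "connected_cat J" and func: "is_functor J (Zigzags C) D"
begin

abbreviation Z :: "'j \<Rightarrow> ('o, 'm) zigzag" where "Z \<equiv> FObj D"
abbreviation N :: "'j \<Rightarrow> nat" where "N j \<equiv> zlen (FObj D j)"
abbreviation sing :: "'a \<Rightarrow> mono_map" where "sing \<sigma> \<equiv> zsing (FArr D \<sigma>)"

text \<open>Apart from the existence of an object, this is the only way in which connectedness enters.\<close>

lemma connected_const:
  assumes "j \<in> Obj J" "j' \<in> Obj J" "\<And>\<sigma>. \<sigma> \<in> Arr J \<Longrightarrow> X (Dom J \<sigma>) = X (Cod J \<sigma>)"
  shows "X j = X j'"
proof -
  let ?R = "{(Dom J f, Cod J f) | f. f \<in> Arr J}"
  have "(j, j') \<in> (?R \<union> ?R\<inverse>)\<^sup>*"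
    using conn assms(1,2) unfolding connected_cat_def Let_def by blast
  then show ?thesis
  proof (induction rule: rtrancl_induct)
    case (step y z)
    then show ?case using assms(3) by auto
  qed simp
qed

lemma ex_obj: "\<exists>j. j \<in> Obj J"
  using conn by (auto simp: connected_cat_def)

lemma Z_zigzag: "j \<in> Obj J \<Longrightarrow> is_zigzag C (Z j)"
  using func by (auto simp: is_functor_def Zigzags_def)

lemma D_zmap:
  assumes "\<sigma> \<in> Arr J"
  shows "is_zmap C (FArr D \<sigma>)" "zdom (FArr D \<sigma>) = Z (Dom J \<sigma>)" "zcod (FArr D \<sigma>) = Z (Cod J \<sigma>)"
  using func assms by (auto simp: is_functor_def Zigzags_def Hom_def)

lemma D_sing:
  assumes "\<sigma> \<in> Arr J"
  shows "is_mono_map (sing \<sigma>)" "mdom (sing \<sigma>) = N (Dom J \<sigma>)" "mcod (sing \<sigma>) = N (Cod J \<sigma>)"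
  using zmap_simps(3-5)[OF D_zmap(1)] D_zmap(2,3) assms by auto

definition sing_cocone :: "nat \<Rightarrow> ('j \<Rightarrow> mono_map) \<Rightarrow> bool" where
  "sing_cocone n hs \<longleftrightarrow>
     (\<forall>j\<in>Obj J. is_mono_map (hs j) \<and> mdom (hs j) = N j \<and> mcod (hs j) = n) \<and>
     (\<forall>\<sigma>\<in>Arr J. mono_comp (hs (Cod J \<sigma>)) (sing \<sigma>) = hs (Dom J \<sigma>))"

lemma sing_cocone_iff:
  "is_cocone Delta (ftor_diagram J (ftor_comp Sing D)) n hs \<longleftrightarrow> sing_cocone n hs"
  unfolding is_cocone_def sing_cocone_def ftor_diagram_def ftor_comp_def Sing_def
  by (simp add: Hom_Delta_iff) (simp add: Delta_def)

lemma sing_coconeD: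
  assumes "sing_cocone n hs" "j \<in> Obj J"
  shows "is_mono_map (hs j)" "mdom (hs j) = N j" "mcod (hs j) = n"
  using assms by (auto simp: sing_cocone_def)

text \<open>The cut points of the pieces are preserved by the regular parts of the maps \<open>D(\<sigma>)\<close>, so these maps
  restrict to pieces.\<close>

lemma sing_cocone_dual:
  assumes "sing_cocone n hs" "\<sigma> \<in> Arr J"
  shows "dual (hs (Dom J \<sigma>)) l = zreg (FArr D \<sigma>) (dual (hs (Cod J \<sigma>)) l)"
proof -
  have "dual (mono_comp (hs (Cod J \<sigma>)) (sing \<sigma>)) l = dual (sing \<sigma>) (dual (hs (Cod J \<sigma>)) l)"
    using assms sing_coconeD[OF assms(1) J.cod_obj[OF assms(2)]] D_sing[OF assms(2)]
    by (intro dual_mono_comp) auto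
  then show ?thesis using assms by (simp add: sing_cocone_def zreg_def)
qed

lemma sing_cocone_vals:
  assumes "sing_cocone n hs" "\<sigma> \<in> Arr J" "i < N (Dom J \<sigma>)"
  shows "vals (hs (Cod J \<sigma>)) ! (vals (sing \<sigma>) ! i) = vals (hs (Dom J \<sigma>)) ! i"
proof -
  have "hs (Dom J \<sigma>) = mono_comp (hs (Cod J \<sigma>)) (sing \<sigma>)"
    using assms by (simp add: sing_cocone_def)
  then show ?thesis using D_sing[OF assms(2)] assms(3) by simp
qed

lemma sing_cocone_dual_le:
  assumes "sing_cocone n hs" "j \<in> Obj J"
  shows "dual (hs j) l \<le> N j" "l \<le> l' \<Longrightarrow> dual (hs j) l \<le> dual (hs j) l'"
  using sing_coconeD[OF assms] dual_le_mdom[of "hs j" l] dual_mono[of "hs j"] by auto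

lemma sing_cocone_fibre:
  assumes "sing_cocone n hs" "j \<in> Obj J" "i < N j"
  shows "vals (hs j) ! i = l \<longleftrightarrow> dual (hs j) l \<le> i \<and> i < dual (hs j) (Suc l)"
  using fibre_iff[of "hs j" i l] sing_coconeD[OF assms(1,2)] assms(3) by simp

lemma sing_cocone_dual_ends:
  assumes "sing_cocone n hs" "j \<in> Obj J"
  shows "dual (hs j) 0 = 0" "dual (hs j) n = N j"
  using dual_0[of "hs j"] dual_mcod[of "hs j"] sing_coconeD[OF assms] by auto

text \<open>A cocone on the deconstruction of the \<open>l\<close>-th piece, with the vertices indexed by their
  positions in the whole zigzags \<open>Z j\<close>.  Pieces for different cocones \<open>hs\<close> are then comparable
  without any shift of indices.\<close>

definition block_cocone ::
  "('j \<Rightarrow> mono_map) \<Rightarrow> nat \<Rightarrow> 'o \<Rightarrow> ('j \<Rightarrow> nat \<Rightarrow> 'm) \<Rightarrow> ('j \<Rightarrow> nat \<Rightarrow> 'm) \<Rightarrow> bool" where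
  "block_cocone hs l p S R \<longleftrightarrow> p \<in> Obj C \<and>
     (\<forall>j\<in>Obj J. \<forall>i. dual (hs j) l \<le> i \<and> i < dual (hs j) (Suc l) \<longrightarrow>
        S j i \<in> Hom C (sobj (Z j) ! i) p) \<and>
     (\<forall>j\<in>Obj J. \<forall>i. dual (hs j) l \<le> i \<and> i < dual (hs j) (Suc l) \<longrightarrow>
        Comp C (S j i) (fwd (Z j) ! i) = R j i) \<and>
     (\<forall>j\<in>Obj J. \<forall>i. dual (hs j) l \<le> i \<and> i < dual (hs j) (Suc l) \<longrightarrow>
        Comp C (S j i) (bwd (Z j) ! i) = R j (Suc i)) \<and>
     (\<forall>j\<in>Obj J. \<forall>i. dual (hs j) l \<le> i \<and> i \<le> dual (hs j) (Suc l) \<longrightarrow>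
        R j i \<in> Hom C (robj (Z j) ! i) p) \<and>
     (\<forall>\<sigma>\<in>Arr J. \<forall>i. dual (hs (Dom J \<sigma>)) l \<le> i \<and> i < dual (hs (Dom J \<sigma>)) (Suc l) \<longrightarrow>
        Comp C (S (Cod J \<sigma>) (vals (sing \<sigma>) ! i)) (zcomp (FArr D \<sigma>) ! i) = S (Dom J \<sigma>) i) \<and>
     (\<forall>\<sigma>\<in>Arr J. \<forall>i. dual (hs (Cod J \<sigma>)) l \<le> i \<and> i \<le> dual (hs (Cod J \<sigma>)) (Suc l) \<longrightarrow>
        R (Dom J \<sigma>) (zreg (FArr D \<sigma>) i) = R (Cod J \<sigma>) i)"

text \<open>Back to the indices local to the \<open>l\<close>-th piece.\<close>

definition glue :: "('j \<Rightarrow> mono_map) \<Rightarrow> nat \<Rightarrow> ('j \<Rightarrow> nat \<Rightarrow> 'm) \<Rightarrow> ('j \<Rightarrow> nat \<Rightarrow> 'm) \<Rightarrow> 'j dvert \<Rightarrow> 'm"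
  where
  "glue hs l S R v = (case v of
      RVert j i \<Rightarrow> R j (dual (hs j) l + i)
    | SVert j i \<Rightarrow> S j (dual (hs j) l + i))"

lemma glue_unglue:
  "glue hs l (\<lambda>j i. \<phi> (SVert j (i - dual (hs j) l))) (\<lambda>j i. \<phi> (RVert j (i - dual (hs j) l))) = \<phi>"
  by (rule ext) (simp add: glue_def split: dvert.split)

lemma piece_obj:
  fixes l :: nat
  assumes hs: "sing_cocone n hs" and j: "j \<in> Obj J"
  defines "a \<equiv> dual (hs j) l" and "b \<equiv> dual (hs j) (Suc l)"
  shows "FObj (piece J D hs l) j = zrestrict (Z j) a b"
    "zlen (FObj (piece J D hs l) j) = b - a"
    "\<And>i. i < b - a \<Longrightarrow> sobj (FObj (piece J D hs l) j) ! i = sobj (Z j) ! (a + i)"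
    "\<And>i. i < b - a \<Longrightarrow> fwd (FObj (piece J D hs l) j) ! i = fwd (Z j) ! (a + i)"
    "\<And>i. i < b - a \<Longrightarrow> bwd (FObj (piece J D hs l) j) ! i = bwd (Z j) ! (a + i)"
    "\<And>i. i \<le> b - a \<Longrightarrow> robj (FObj (piece J D hs l) j) ! i = robj (Z j) ! (a + i)"
proof -
  have le: "a \<le> b" "b \<le> N j" using sing_cocone_dual_le[OF hs j] by (simp_all add: a_def b_def)
  note len = zigzag_simps(1-4)[OF Z_zigzag[OF j]]
  show *: "FObj (piece J D hs l) j = zrestrict (Z j) a b"
    by (simp add: piece_def a_def b_def)
  show "zlen (FObj (piece J D hs l) j) = b - a"
  proof -
    have "zlen (zrestrict (Z j) a b) = length (slice a b (sobj (Z j)))"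
      by (simp add: zlen_def zrestrict_def)
    then show ?thesis using le len by (simp add: * length_slice)
  qed
  show "sobj (FObj (piece J D hs l) j) ! i = sobj (Z j) ! (a + i)"
    "fwd (FObj (piece J D hs l) j) ! i = fwd (Z j) ! (a + i)"
    "bwd (FObj (piece J D hs l) j) ! i = bwd (Z j) ! (a + i)" if "i < b - a" for i
    using le len that by (simp_all add: * zrestrict_def slice_nth)
  show "robj (FObj (piece J D hs l) j) ! i = robj (Z j) ! (a + i)" if "i \<le> b - a" for i
    using le len that by (simp add: * zrestrict_def slice_nth)
qed

lemma piece_arr:
  fixes l :: nat
  assumes hs: "sing_cocone n hs" and \<sigma>: "\<sigma> \<in> Arr J"
  defines "a \<equiv> dual (hs (Dom J \<sigma>)) l" and "b \<equiv> dual (hs (Dom J \<sigma>)) (Suc l)"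
    and "a' \<equiv> dual (hs (Cod J \<sigma>)) l" and "b' \<equiv> dual (hs (Cod J \<sigma>)) (Suc l)"
  shows
    "\<And>i. i < b - a \<Longrightarrow> vals (zsing (FArr (piece J D hs l) \<sigma>)) ! i = vals (sing \<sigma>) ! (a + i) - a'"
    "\<And>i. i < b - a \<Longrightarrow> a' \<le> vals (sing \<sigma>) ! (a + i) \<and> vals (sing \<sigma>) ! (a + i) < b'"
    "\<And>i. i < b - a \<Longrightarrow> zcomp (FArr (piece J D hs l) \<sigma>) ! i = zcomp (FArr D \<sigma>) ! (a + i)"
    "\<And>i. i \<le> b' - a' \<Longrightarrow> zreg (FArr (piece J D hs l) \<sigma>) i = zreg (FArr D \<sigma>) (a' + i) - a"
proof -
  note dj = J.dom_obj[OF \<sigma>] and cj = J.cod_obj[OF \<sigma>]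
  have le: "a \<le> b" "b \<le> N (Dom J \<sigma>)" "a' \<le> b'" "b' \<le> N (Cod J \<sigma>)"
    using sing_cocone_dual_le[OF hs dj] sing_cocone_dual_le[OF hs cj]
    by (simp_all add: a_def b_def a'_def b'_def)
  have reg: "a = zreg (FArr D \<sigma>) a'" "b = zreg (FArr D \<sigma>) b'"
    using sing_cocone_dual[OF hs \<sigma>] by (simp_all add: a_def b_def a'_def b'_def)
  note h = D_sing[OF \<sigma>]
  have len: "length (vals (sing \<sigma>)) = N (Dom J \<sigma>)" "length (zcomp (FArr D \<sigma>)) = N (Dom J \<sigma>)"
    using h zmap_simps(6)[OF D_zmap(1)[OF \<sigma>]] D_zmap(2)[OF \<sigma>] by (simp_all add: mdom_def)
  define g where "g = FArr (piece J D hs l) \<sigma>"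
  have g: "g = zmap_restrict (FArr D \<sigma>) a' b'"
    by (simp add: g_def piece_def a'_def b'_def)
  have sg: "zsing g = \<lparr>vals = map (\<lambda>i. i - a') (slice a b (vals (sing \<sigma>))), mcod = b' - a'\<rparr>"
    by (simp add: g zmap_restrict_def Let_def reg)
  show v: "vals (zsing (FArr (piece J D hs l) \<sigma>)) ! i = vals (sing \<sigma>) ! (a + i) - a'"
    if "i < b - a" for i
    using that le len unfolding g_def[symmetric] sg by (simp add: slice_nth length_slice)
  show w: "a' \<le> vals (sing \<sigma>) ! (a + i) \<and> vals (sing \<sigma>) ! (a + i) < b'"
    if "i < b - a" for i
  proof -
    have ai: "a + i < mdom (sing \<sigma>)" "zreg (FArr D \<sigma>) a' \<le> a + i" "\<not> zreg (FArr D \<sigma>) b' \<le> a + i"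
      using that le h reg by auto
    then show ?thesis
      using dual_le_iff[OF h(1) ai(1), of a'] dual_le_iff[OF h(1) ai(1), of b']
      by (simp add: zreg_def)
  qed
  show "zcomp (FArr (piece J D hs l) \<sigma>) ! i = zcomp (FArr D \<sigma>) ! (a + i)" if "i < b - a" for i
    using that le len unfolding g_def[symmetric] g zmap_restrict_def Let_def
    by (simp add: slice_nth flip: reg)
  have md: "mdom (zsing g) = b - a" using le len by (simp add: sg mdom_def length_slice)
  have mm: "is_mono_map (zsing g)"
  proof (rule is_mono_mapI)
    fix i i' assume "i \<le> i'" "i' < mdom (zsing g)"
    then show "vals (zsing g) ! i \<le> vals (zsing g) ! i'"
      using v[of i] v[of i'] vals_mono[OF h(1), of "a + i" "a + i'"] h(2) le
      unfolding g_def[symmetric] md by (simp add: diff_le_mono)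
  next
    fix i assume "i < mdom (zsing g)"
    then show "vals (zsing g) ! i < mcod (zsing g)"
      using v[of i] w[of i] unfolding g_def[symmetric] md by (auto simp: sg intro: diff_less_mono)
  qed
  show "zreg (FArr (piece J D hs l) \<sigma>) i = zreg (FArr D \<sigma>) (a' + i) - a"
    if i: "i \<le> b' - a'" for i
    unfolding g_def[symmetric] zreg_def
  proof (rule dual_eqI[OF mm])
    have "zreg (FArr D \<sigma>) (a' + i) \<le> b"
      unfolding reg zreg_def using i le by (intro dual_mono[OF h(1)]) auto
    then show "dual (sing \<sigma>) (a' + i) - a \<le> mdom (zsing g)"
      unfolding md zreg_def by simp
  next
    fix x assume "x < mdom (zsing g)"
    then have x: "x < b - a" by (simp add: md)
    then have "dual (sing \<sigma>) (a' + i) \<le> a + x \<longleftrightarrow> a' + i \<le> vals (sing \<sigma>) ! (a + x)"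
      using h(2) le by (intro dual_le_iff[OF h(1)]) auto
    then show "dual (sing \<sigma>) (a' + i) - a \<le> x \<longleftrightarrow> i \<le> vals (zsing g) ! x"
      using v[OF x] w[OF x] unfolding g_def[symmetric] by auto
  qed
qed

lemma block_coconeD:
  assumes "block_cocone hs l p S R"
  shows "p \<in> Obj C"
    "\<And>j i. j \<in> Obj J \<Longrightarrow> dual (hs j) l \<le> i \<Longrightarrow> i < dual (hs j) (Suc l) \<Longrightarrow>
       S j i \<in> Hom C (sobj (Z j) ! i) p"
    "\<And>j i. j \<in> Obj J \<Longrightarrow> dual (hs j) l \<le> i \<Longrightarrow> i < dual (hs j) (Suc l) \<Longrightarrow>
       Comp C (S j i) (fwd (Z j) ! i) = R j i"
    "\<And>j i. j \<in> Obj J \<Longrightarrow> dual (hs j) l \<le> i \<Longrightarrow> i < dual (hs j) (Suc l) \<Longrightarrow>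
       Comp C (S j i) (bwd (Z j) ! i) = R j (Suc i)"
    "\<And>j i. j \<in> Obj J \<Longrightarrow> dual (hs j) l \<le> i \<Longrightarrow> i \<le> dual (hs j) (Suc l) \<Longrightarrow>
       R j i \<in> Hom C (robj (Z j) ! i) p"
    "\<And>\<sigma> i. \<sigma> \<in> Arr J \<Longrightarrow> dual (hs (Dom J \<sigma>)) l \<le> i \<Longrightarrow> i < dual (hs (Dom J \<sigma>)) (Suc l) \<Longrightarrow>
       Comp C (S (Cod J \<sigma>) (vals (sing \<sigma>) ! i)) (zcomp (FArr D \<sigma>) ! i) = S (Dom J \<sigma>) i"
    "\<And>\<sigma> i. \<sigma> \<in> Arr J \<Longrightarrow> dual (hs (Cod J \<sigma>)) l \<le> i \<Longrightarrow> i \<le> dual (hs (Cod J \<sigma>)) (Suc l) \<Longrightarrow>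
       R (Dom J \<sigma>) (zreg (FArr D \<sigma>) i) = R (Cod J \<sigma>) i"
  using assms unfolding block_cocone_def by simp_all

lemma deconstruction_cocone_iff:
  "is_cocone C (deconstruction C J E) p \<phi> \<longleftrightarrow> p \<in> Obj C \<and>
     (\<forall>j\<in>Obj J. \<forall>i<zlen (FObj E j). \<phi> (SVert j i) \<in> Hom C (sobj (FObj E j) ! i) p) \<and>
     (\<forall>j\<in>Obj J. \<forall>i<zlen (FObj E j). Comp C (\<phi> (SVert j i)) (fwd (FObj E j) ! i) = \<phi> (RVert j i)) \<and>
     (\<forall>j\<in>Obj J. \<forall>i<zlen (FObj E j). Comp C (\<phi> (SVert j i)) (bwd (FObj E j) ! i) = \<phi> (RVert j (Suc i))) \<and>
     (\<forall>j\<in>Obj J. \<forall>i\<le>zlen (FObj E j). \<phi> (RVert j i) \<in> Hom C (robj (FObj E j) ! i) p) \<and>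
     (\<forall>\<sigma>\<in>Arr J. \<forall>i<zlen (FObj E (Dom J \<sigma>)).
        Comp C (\<phi> (SVert (Cod J \<sigma>) (vals (zsing (FArr E \<sigma>)) ! i))) (zcomp (FArr E \<sigma>) ! i) =
        \<phi> (SVert (Dom J \<sigma>) i)) \<and>
     (\<forall>\<sigma>\<in>Arr J. \<forall>i\<le>zlen (FObj E (Cod J \<sigma>)).
        Comp C (\<phi> (RVert (Dom J \<sigma>) (zreg (FArr E \<sigma>) i))) (Ident C (robj (FObj E (Cod J \<sigma>)) ! i)) =
        \<phi> (RVert (Cod J \<sigma>) i))"
proof -
  have ball: "(\<forall>x\<in>{f a i | a i. a \<in> A \<and> Q a i}. P x) \<longleftrightarrow> (\<forall>a\<in>A. \<forall>i. Q a i \<longrightarrow> P (f a i))"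
    for f :: "'x \<Rightarrow> nat \<Rightarrow> 'y" and A Q P
    by blast
  show ?thesis
    unfolding is_cocone_def deconstruction_def diagram.simps ball_Un ball
    unfolding dvert.case dedge.case Suc_eq_plus1 by argo
qed

text \<open>Besides the shift of indices, the identity labels of the arrows between regular vertices are
  absorbed; this uses that these arrows join equal objects.\<close>

lemma piece_cocone_iff:
  assumes hs: "sing_cocone n hs"
  shows "is_cocone C (deconstruction C J (piece J D hs l)) p (glue hs l S R) \<longleftrightarrow>
    block_cocone hs l p S R"
proof -
  let ?E = "piece J D hs l" and ?\<phi> = "glue hs l S R"
  let ?a = "\<lambda>j. dual (hs j) l" and ?b = "\<lambda>j. dual (hs j) (Suc l)"
  have ab: "?a j \<le> ?b j" if "j \<in> Obj J" for j using sing_cocone_dual_le[OF hs that] by simp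
  have len: "zlen (FObj ?E j) = ?b j - ?a j" if "j \<in> Obj J" for j using piece_obj[OF hs that] by simp
  have 1: "(\<forall>j\<in>Obj J. \<forall>i<zlen (FObj ?E j). ?\<phi> (SVert j i) \<in> Hom C (sobj (FObj ?E j) ! i) p) \<longleftrightarrow>
      (\<forall>j\<in>Obj J. \<forall>i. ?a j \<le> i \<and> i < ?b j \<longrightarrow> S j i \<in> Hom C (sobj (Z j) ! i) p)"
    by (intro ball_cong refl, subst all_less_shift[symmetric])
      (simp add: len piece_obj(3-6)[OF hs] glue_def)
  have 2: "(\<forall>j\<in>Obj J. \<forall>i<zlen (FObj ?E j). Comp C (?\<phi> (SVert j i)) (fwd (FObj ?E j) ! i) = ?\<phi> (RVert j i)) \<longleftrightarrow>
      (\<forall>j\<in>Obj J. \<forall>i. ?a j \<le> i \<and> i < ?b j \<longrightarrow> Comp C (S j i) (fwd (Z j) ! i) = R j i)"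
    by (intro ball_cong refl, subst all_less_shift[symmetric])
      (simp add: len piece_obj(3-6)[OF hs] glue_def)
  have 3: "(\<forall>j\<in>Obj J. \<forall>i<zlen (FObj ?E j). Comp C (?\<phi> (SVert j i)) (bwd (FObj ?E j) ! i) = ?\<phi> (RVert j (Suc i))) \<longleftrightarrow>
      (\<forall>j\<in>Obj J. \<forall>i. ?a j \<le> i \<and> i < ?b j \<longrightarrow> Comp C (S j i) (bwd (Z j) ! i) = R j (Suc i))"
    by (intro ball_cong refl, subst all_less_shift[symmetric])
      (simp add: len piece_obj(3-6)[OF hs] glue_def)
  have 4: "(\<forall>j\<in>Obj J. \<forall>i\<le>zlen (FObj ?E j). ?\<phi> (RVert j i) \<in> Hom C (robj (FObj ?E j) ! i) p) \<longleftrightarrow>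
      (\<forall>j\<in>Obj J. \<forall>i. ?a j \<le> i \<and> i \<le> ?b j \<longrightarrow> R j i \<in> Hom C (robj (Z j) ! i) p)"
    by (intro ball_cong refl, subst all_le_shift[symmetric])
      (simp_all add: ab len piece_obj(3-6)[OF hs] glue_def)
  have 5: "(\<forall>\<sigma>\<in>Arr J. \<forall>i<zlen (FObj ?E (Dom J \<sigma>)).
        Comp C (?\<phi> (SVert (Cod J \<sigma>) (vals (zsing (FArr ?E \<sigma>)) ! i))) (zcomp (FArr ?E \<sigma>) ! i) =
        ?\<phi> (SVert (Dom J \<sigma>) i)) \<longleftrightarrow>
      (\<forall>\<sigma>\<in>Arr J. \<forall>i. ?a (Dom J \<sigma>) \<le> i \<and> i < ?b (Dom J \<sigma>) \<longrightarrow>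
        Comp C (S (Cod J \<sigma>) (vals (sing \<sigma>) ! i)) (zcomp (FArr D \<sigma>) ! i) = S (Dom J \<sigma>) i)"
    by (intro ball_cong refl, subst all_less_shift[symmetric])
      (simp add: len J.dom_obj piece_arr[OF hs] glue_def)
  have 6: "(\<forall>\<sigma>\<in>Arr J. \<forall>i\<le>zlen (FObj ?E (Cod J \<sigma>)).
        Comp C (?\<phi> (RVert (Dom J \<sigma>) (zreg (FArr ?E \<sigma>) i))) (Ident C (robj (FObj ?E (Cod J \<sigma>)) ! i)) =
        ?\<phi> (RVert (Cod J \<sigma>) i)) \<longleftrightarrow>
      (\<forall>\<sigma>\<in>Arr J. \<forall>i. ?a (Cod J \<sigma>) \<le> i \<and> i \<le> ?b (Cod J \<sigma>) \<longrightarrow>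
        R (Dom J \<sigma>) (zreg (FArr D \<sigma>) i) = R (Cod J \<sigma>) i)"
    if R: "\<forall>j\<in>Obj J. \<forall>i. ?a j \<le> i \<and> i \<le> ?b j \<longrightarrow> R j i \<in> Hom C (robj (Z j) ! i) p"
  proof (intro ball_cong refl, subst all_le_shift[symmetric])
    fix \<sigma> assume \<sigma>: "\<sigma> \<in> Arr J"
    note dj = J.dom_obj[OF \<sigma>] and cj = J.cod_obj[OF \<sigma>]
    show "?a (Cod J \<sigma>) \<le> ?b (Cod J \<sigma>)" by (rule ab[OF cj])
    have "Comp C (?\<phi> (RVert (Dom J \<sigma>) (zreg (FArr ?E \<sigma>) i))) (Ident C (robj (FObj ?E (Cod J \<sigma>)) ! i)) =
        R (Dom J \<sigma>) (zreg (FArr D \<sigma>) (?a (Cod J \<sigma>) + i))"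
      if i: "i \<le> ?b (Cod J \<sigma>) - ?a (Cod J \<sigma>)" for i
    proof -
      let ?i = "?a (Cod J \<sigma>) + i"
      have bnd: "?i \<le> ?b (Cod J \<sigma>)" "?i \<le> N (Cod J \<sigma>)"
        using i ab[OF cj] sing_cocone_dual_le(1)[OF hs cj, of "Suc l"] by auto
      have reg: "?a (Dom J \<sigma>) \<le> zreg (FArr D \<sigma>) ?i" "zreg (FArr D \<sigma>) ?i \<le> ?b (Dom J \<sigma>)"
        unfolding sing_cocone_dual[OF hs \<sigma>] zreg_def
        using bnd by (auto intro: dual_mono[OF D_sing(1)[OF \<sigma>]])
      have "robj (Z (Cod J \<sigma>)) ! ?i = robj (Z (Dom J \<sigma>)) ! zreg (FArr D \<sigma>) ?i"
        using zmap_simps(8)[OF D_zmap(1)[OF \<sigma>]] D_zmap(2,3)[OF \<sigma>] bnd by simp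
      moreover have "R (Dom J \<sigma>) (zreg (FArr D \<sigma>) ?i) \<in>
          Hom C (robj (Z (Dom J \<sigma>)) ! zreg (FArr D \<sigma>) ?i) p"
        using R dj reg by blast
      ultimately have "Comp C (R (Dom J \<sigma>) (zreg (FArr D \<sigma>) ?i)) (Ident C (robj (Z (Cod J \<sigma>)) ! ?i)) =
          R (Dom J \<sigma>) (zreg (FArr D \<sigma>) ?i)"
        using Hom_comp_ident(1) by simp
      then show ?thesis
        using i reg piece_obj(6)[OF hs cj i] piece_arr(4)[OF hs \<sigma> i] by (simp add: glue_def)
    qed
    then show "(\<forall>i\<le>zlen (FObj ?E (Cod J \<sigma>)).
        Comp C (?\<phi> (RVert (Dom J \<sigma>) (zreg (FArr ?E \<sigma>) i))) (Ident C (robj (FObj ?E (Cod J \<sigma>)) ! i)) =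
        ?\<phi> (RVert (Cod J \<sigma>) i)) \<longleftrightarrow>
      (\<forall>i\<le>?b (Cod J \<sigma>) - ?a (Cod J \<sigma>).
        R (Dom J \<sigma>) (zreg (FArr D \<sigma>) (?a (Cod J \<sigma>) + i)) = R (Cod J \<sigma>) (?a (Cod J \<sigma>) + i))"
      by (simp add: len[OF cj]) (simp add: glue_def)
  qed
  show ?thesis
  proof (cases "\<forall>j\<in>Obj J. \<forall>i. ?a j \<le> i \<and> i \<le> ?b j \<longrightarrow> R j i \<in> Hom C (robj (Z j) ! i) p")
    case True
    show ?thesis
      unfolding deconstruction_cocone_iff block_cocone_def 1 2 3 4 5 6[OF True] by (rule refl)
  next
    case False
    then show ?thesis
      unfolding deconstruction_cocone_iff block_cocone_def 1 2 3 4 5 by blast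
  qed
qed


section \<open>Cocones as families of glued blocks\<close>

text \<open>\<open>S l\<close> and \<open>R l\<close> are meaningful only inside the \<open>l\<close>-th block.  They carry the index \<open>l\<close> so that
  blocks with unrelated apexes can be combined; neighbouring blocks share a regular object, at which
  \<open>R l\<close> and \<open>R (Suc l)\<close> have different codomains in general.\<close>

definition sliced_cocone ::
  "('o, 'm) zigzag \<Rightarrow> ('j \<Rightarrow> mono_map) \<Rightarrow> (nat \<Rightarrow> 'j \<Rightarrow> nat \<Rightarrow> 'm) \<Rightarrow> (nat \<Rightarrow> 'j \<Rightarrow> nat \<Rightarrow> 'm) \<Rightarrow> bool"
  where
  "sliced_cocone A hs S R \<longleftrightarrow> is_zigzag C A \<and> sing_cocone (zlen A) hs \<and>
     (\<forall>l<zlen A. block_cocone hs l (sobj A ! l) (S l) (R l)) \<and>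
     (\<forall>j\<in>Obj J. \<forall>l\<le>zlen A. robj A ! l = robj (Z j) ! dual (hs j) l) \<and>
     (\<forall>j\<in>Obj J. \<forall>l<zlen A.
        fwd A ! l = R l j (dual (hs j) l) \<and> bwd A ! l = R l j (dual (hs j) (Suc l)))"

definition leg ::
  "('o, 'm) zigzag \<Rightarrow> ('j \<Rightarrow> mono_map) \<Rightarrow> (nat \<Rightarrow> 'j \<Rightarrow> nat \<Rightarrow> 'm) \<Rightarrow> 'j \<Rightarrow> ('o, 'm) zmap" where
  "leg A hs S j = \<lparr>zdom = Z j, zcod = A, zsing = hs j,
     zcomp = map (\<lambda>i. S (vals (hs j) ! i) j i) [0..<N j]\<rparr>"

lemma leg_simps [simp]:
  "zdom (leg A hs S j) = Z j" "zcod (leg A hs S j) = A" "zsing (leg A hs S j) = hs j"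
  "length (zcomp (leg A hs S j)) = N j"
  "i < N j \<Longrightarrow> zcomp (leg A hs S j) ! i = S (vals (hs j) ! i) j i"
  by (simp_all add: leg_def)

lemma sliced_coconeD:
  assumes "sliced_cocone A hs S R"
  shows "is_zigzag C A" "sing_cocone (zlen A) hs"
    "\<And>l. l < zlen A \<Longrightarrow> block_cocone hs l (sobj A ! l) (S l) (R l)"
    "\<And>j l. j \<in> Obj J \<Longrightarrow> l \<le> zlen A \<Longrightarrow> robj A ! l = robj (Z j) ! dual (hs j) l"
    "\<And>j l. j \<in> Obj J \<Longrightarrow> l < zlen A \<Longrightarrow> fwd A ! l = R l j (dual (hs j) l)"
    "\<And>j l. j \<in> Obj J \<Longrightarrow> l < zlen A \<Longrightarrow> bwd A ! l = R l j (dual (hs j) (Suc l))"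
  using assms unfolding sliced_cocone_def by simp_all

lemma sliced_cocone_vals:
  assumes A: "sliced_cocone A hs S R" and j: "j \<in> Obj J" and i: "i < N j"
  shows "vals (hs j) ! i < zlen A"
    "dual (hs j) (vals (hs j) ! i) \<le> i" "i < dual (hs j) (Suc (vals (hs j) ! i))"
  using sing_coconeD[OF sliced_coconeD(2)[OF A] j] vals_less_mcod[of "hs j" i] i
    sing_cocone_fibre[OF sliced_coconeD(2)[OF A] j i] by auto

lemma leg_is_zmap:
  assumes A: "sliced_cocone A hs S R" and j: "j \<in> Obj J"
  shows "is_zmap C (leg A hs S j)"
proof (rule is_zmapI[where R = "\<lambda>l i. R l j i"], unfold leg_simps(1-4))
  note B = sliced_coconeD[OF A] and v = sliced_cocone_vals[OF A j]
  show "is_zigzag C (Z j)" by (rule Z_zigzag[OF j])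
  show "is_zigzag C A" by (rule B)
  show "is_mono_map (hs j)" "mdom (hs j) = N j" "mcod (hs j) = zlen A"
    using sing_coconeD[OF B(2) j] by auto
  show "zcomp (leg A hs S j) ! i \<in> Hom C (sobj (Z j) ! i) (sobj A ! (vals (hs j) ! i))"
    if "i < N j" for i
    using that block_coconeD(2)[OF B(3) j] v by simp
  show "robj A ! l = robj (Z j) ! zreg (leg A hs S j) l" if "l \<le> zlen A" for l
    using B(4)[OF j that] by (simp add: zreg_def)
  show "R l j (zreg (leg A hs S j) l) = fwd A ! l"
    "R l j (zreg (leg A hs S j) (Suc l)) = bwd A ! l" if "l < zlen A" for l
    using B(5,6)[OF j that] by (simp_all add: zreg_def)
  show "Comp C (zcomp (leg A hs S j) ! i) (fwd (Z j) ! i) = R l j i"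
    "Comp C (zcomp (leg A hs S j) ! i) (bwd (Z j) ! i) = R l j (Suc i)"
    if "l < zlen A" "i < N j" "vals (hs j) ! i = l" for l i
    using block_coconeD(3,4)[OF B(3) j] v[OF that(2)] that by simp_all
qed simp

lemma sliced_cocone_is_cocone:
  assumes A: "sliced_cocone A hs S R"
  shows "is_cocone (Zigzags C) (ftor_diagram J D) A (leg A hs S)"
proof -
  note B = sliced_coconeD[OF A]
  have "zmap_comp C (leg A hs S (Cod J \<sigma>)) (FArr D \<sigma>) = leg A hs S (Dom J \<sigma>)" if \<sigma>: "\<sigma> \<in> Arr J" for \<sigma>
  proof -
    note dj = J.dom_obj[OF \<sigma>] and cj = J.cod_obj[OF \<sigma>]
    have "Comp C (zcomp (leg A hs S (Cod J \<sigma>)) ! (vals (sing \<sigma>) ! i)) (zcomp (FArr D \<sigma>) ! i) =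
        S (vals (hs (Dom J \<sigma>)) ! i) (Dom J \<sigma>) i" if i: "i < N (Dom J \<sigma>)" for i
    proof -
      have "vals (sing \<sigma>) ! i < N (Cod J \<sigma>)"
        using vals_less_mcod[OF D_sing(1)[OF \<sigma>], of i] D_sing[OF \<sigma>] i by simp
      then show ?thesis
        using sing_cocone_vals[OF B(2) \<sigma> i] sliced_cocone_vals[OF A dj i]
          block_coconeD(6)[OF B(3) \<sigma>] by simp
    qed
    then show ?thesis
      using B(2) \<sigma> D_zmap[OF \<sigma>] by (simp add: zmap_comp_def leg_def sing_cocone_def)
  qed
  then show ?thesis
    using B(1) leg_is_zmap[OF A] by (simp add: is_cocone_def Zigzags_def ftor_diagram_def Hom_def)
qed

text \<open>Cutting a cocone of zigzag maps.  The condition on the arrows between regular vertices is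
  \<open>reg_arrow_comp\<close>; the others are read off componentwise.\<close>

lemma cocone_sliced:
  assumes "is_cocone (Zigzags C) (ftor_diagram J D) A \<psi>"
  defines "hs \<equiv> \<lambda>j. zsing (\<psi> j)" and "S \<equiv> \<lambda>l j i. zcomp (\<psi> j) ! i"
    and "R \<equiv> \<lambda>l j i. reg_arrow C (\<psi> j) l i"
  shows "sliced_cocone A hs S R" and "j \<in> Obj J \<Longrightarrow> \<psi> j = leg A hs S j"
proof -
  have A: "is_zigzag C A"
    and \<psi>: "\<And>j. j \<in> Obj J \<Longrightarrow> is_zmap C (\<psi> j)" "\<And>j. j \<in> Obj J \<Longrightarrow> zdom (\<psi> j) = Z j"
      "\<And>j. j \<in> Obj J \<Longrightarrow> zcod (\<psi> j) = A"
    and comp: "\<And>\<sigma>. \<sigma> \<in> Arr J \<Longrightarrow> zmap_comp C (\<psi> (Cod J \<sigma>)) (FArr D \<sigma>) = \<psi> (Dom J \<sigma>)"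
    using assms(1) by (auto simp: is_cocone_def Zigzags_def ftor_diagram_def Hom_def)
  have hs: "is_mono_map (hs j)" "mdom (hs j) = N j" "mcod (hs j) = zlen A"
    and reg: "zreg (\<psi> j) = dual (hs j)" if "j \<in> Obj J" for j
    using zmap_simps(3-5)[OF \<psi>(1)[OF that]] \<psi>(2,3)[OF that]
    by (simp_all add: hs_def zreg_def)
  have sing: "sing_cocone (zlen A) hs"
    unfolding sing_cocone_def
  proof (intro conjI ballI)
    fix \<sigma> assume "\<sigma> \<in> Arr J"
    from arg_cong[OF comp[OF this], of zsing]
    show "mono_comp (hs (Cod J \<sigma>)) (sing \<sigma>) = hs (Dom J \<sigma>)"
      by (simp add: hs_def zmap_comp_def)
  qed (simp_all add: hs)
  have block: "block_cocone hs l (sobj A ! l) (S l) (R l)" if l: "l < zlen A" for l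
    unfolding block_cocone_def
  proof (intro conjI ballI allI impI)
    show "sobj A ! l \<in> Obj C" using zigzag_simps(6)[OF A l] .
  next
    fix j i assume j: "j \<in> Obj J" and "dual (hs j) l \<le> i \<and> i < dual (hs j) (Suc l)"
    moreover from this have i: "i < N j"
      using sing_cocone_dual_le(1)[OF sing j, of "Suc l"] by linarith
    ultimately have v: "vals (zsing (\<psi> j)) ! i = l"
      using sing_cocone_fibre[OF sing j i] by (simp add: hs_def)
    show "S l j i \<in> Hom C (sobj (Z j) ! i) (sobj A ! l)"
      using zmap_simps(7)[OF \<psi>(1)[OF j], of i] \<psi>(2,3)[OF j] i v by (simp add: S_def)
    show "Comp C (S l j i) (fwd (Z j) ! i) = R l j i"
      using reg_arrow_fwd[OF \<psi>(1)[OF j], of l i] \<psi>(2,3)[OF j] l i v by (simp add: S_def R_def)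
    show "Comp C (S l j i) (bwd (Z j) ! i) = R l j (Suc i)"
      using reg_arrow_bwd[OF \<psi>(1)[OF j], of l i] \<psi>(2,3)[OF j] l i v by (simp add: S_def R_def)
  next
    fix j i assume j: "j \<in> Obj J" and "dual (hs j) l \<le> i \<and> i \<le> dual (hs j) (Suc l)"
    then show "R l j i \<in> Hom C (robj (Z j) ! i) (sobj A ! l)"
      using reg_arrow_hom[OF \<psi>(1)[OF j], of l i] \<psi>(2,3)[OF j] l by (simp add: R_def reg[OF j])
  next
    fix \<sigma> i assume \<sigma>: "\<sigma> \<in> Arr J" and "dual (hs (Dom J \<sigma>)) l \<le> i \<and> i < dual (hs (Dom J \<sigma>)) (Suc l)"
    then have i: "i < N (Dom J \<sigma>)"
      using sing_cocone_dual_le(1)[OF sing J.dom_obj[OF \<sigma>], of "Suc l"] by linarith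
    have "zcomp (\<psi> (Dom J \<sigma>)) ! i = zcomp (zmap_comp C (\<psi> (Cod J \<sigma>)) (FArr D \<sigma>)) ! i"
      by (simp add: comp[OF \<sigma>])
    also have "\<dots> = Comp C (zcomp (\<psi> (Cod J \<sigma>)) ! (vals (sing \<sigma>) ! i)) (zcomp (FArr D \<sigma>) ! i)"
      using i D_zmap(2)[OF \<sigma>] by (simp add: zmap_comp_def)
    finally show "Comp C (S l (Cod J \<sigma>) (vals (sing \<sigma>) ! i)) (zcomp (FArr D \<sigma>) ! i) =
        S l (Dom J \<sigma>) i"
      by (simp add: S_def)
  next
    fix \<sigma> i assume \<sigma>: "\<sigma> \<in> Arr J" and i: "dual (hs (Cod J \<sigma>)) l \<le> i \<and> i \<le> dual (hs (Cod J \<sigma>)) (Suc l)"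
    note dj = J.dom_obj[OF \<sigma>] and cj = J.cod_obj[OF \<sigma>]
    have "reg_arrow C (zmap_comp C (\<psi> (Cod J \<sigma>)) (FArr D \<sigma>)) l (zreg (FArr D \<sigma>) i) =
        reg_arrow C (\<psi> (Cod J \<sigma>)) l i"
    proof (rule reg_arrow_comp[OF D_zmap(1)[OF \<sigma>] \<psi>(1)[OF cj]])
      show "zcod (FArr D \<sigma>) = zdom (\<psi> (Cod J \<sigma>))" using D_zmap(3)[OF \<sigma>] \<psi>(2)[OF cj] by simp
      show "is_zmap C (zmap_comp C (\<psi> (Cod J \<sigma>)) (FArr D \<sigma>))" using \<psi>(1)[OF dj] comp[OF \<sigma>] by simp
    qed (use l i \<psi>(3)[OF cj] reg[OF cj] in auto)
    then show "R l (Dom J \<sigma>) (zreg (FArr D \<sigma>) i) = R l (Cod J \<sigma>) i"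
      by (simp add: R_def comp[OF \<sigma>])
  qed
  show "sliced_cocone A hs S R"
    unfolding sliced_cocone_def
  proof (intro conjI ballI allI impI A sing block)
    fix j l assume j: "j \<in> Obj J"
    show "robj A ! l = robj (Z j) ! dual (hs j) l" if "l \<le> zlen A"
      using zmap_simps(8)[OF \<psi>(1)[OF j], of l] that by (simp add: \<psi>[OF j] reg[OF j])
    show "fwd A ! l = R l j (dual (hs j) l)" "bwd A ! l = R l j (dual (hs j) (Suc l))"
      if "l < zlen A"
      using reg_arrow_first[OF \<psi>(1)[OF j], of l] reg_arrow_last[OF \<psi>(1)[OF j], of l] that
      by (simp_all add: \<psi>[OF j] reg[OF j] R_def)
  qed
  show "\<psi> j = leg A hs S j" if j: "j \<in> Obj J"
  proof -
    have "zcomp (\<psi> j) = map (\<lambda>i. zcomp (\<psi> j) ! i) [0..<N j]"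
      using zmap_simps(6)[OF \<psi>(1)[OF j]] \<psi>(2)[OF j] by (metis map_nth)
    then show ?thesis using \<psi>(2,3)[OF j] by (simp add: leg_def hs_def S_def)
  qed
qed

text \<open>Cut points correspond to cut points under every \<open>D(\<sigma>)\<close>, and the legs there are related by
  identities; so the values at cut points are constant along \<open>J\<close>.\<close>

lemma block_ends_const:
  assumes hs: "sing_cocone n hs" and b: "block_cocone hs l p S R"
    and j: "j \<in> Obj J" "j' \<in> Obj J"
  shows "R j (dual (hs j) l) = R j' (dual (hs j') l)"
    "R j (dual (hs j) (Suc l)) = R j' (dual (hs j') (Suc l))"
proof -
  have le: "dual (hs j) l \<le> dual (hs j) (Suc l)" if "j \<in> Obj J" for j
    using sing_cocone_dual_le(2)[OF hs that] by simp
  show "R j (dual (hs j) l) = R j' (dual (hs j') l)"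
    using j by (rule connected_const)
      (use sing_cocone_dual[OF hs] block_coconeD(7)[OF b] le J.cod_obj in simp)
  show "R j (dual (hs j) (Suc l)) = R j' (dual (hs j') (Suc l))"
    using j by (rule connected_const)
      (use sing_cocone_dual[OF hs] block_coconeD(7)[OF b] le J.cod_obj in simp)
qed

lemma robj_dual_const:
  assumes hs: "sing_cocone n hs" and j: "j \<in> Obj J" "j' \<in> Obj J"
  shows "robj (Z j) ! dual (hs j) l = robj (Z j') ! dual (hs j') l"
proof (rule connected_const[OF j])
  fix \<sigma> assume \<sigma>: "\<sigma> \<in> Arr J"
  show "robj (Z (Dom J \<sigma>)) ! dual (hs (Dom J \<sigma>)) l = robj (Z (Cod J \<sigma>)) ! dual (hs (Cod J \<sigma>)) l"
    using zmap_simps(8)[OF D_zmap(1)[OF \<sigma>], of "dual (hs (Cod J \<sigma>)) l"] D_zmap(2,3)[OF \<sigma>]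
      sing_cocone_dual[OF hs \<sigma>] sing_cocone_dual_le(1)[OF hs J.cod_obj[OF \<sigma>]] by simp
qed

text \<open>Built from one index \<open>j\<close>; if the data are block cocones, any other index gives the same zigzag.\<close>

definition glued ::
  "nat \<Rightarrow> ('j \<Rightarrow> mono_map) \<Rightarrow> (nat \<Rightarrow> 'o) \<Rightarrow> (nat \<Rightarrow> 'j \<Rightarrow> nat \<Rightarrow> 'm) \<Rightarrow> 'j \<Rightarrow> ('o, 'm) zigzag" where
  "glued n hs P R j = \<lparr>robj = map (\<lambda>l. robj (Z j) ! dual (hs j) l) [0..<Suc n],
     sobj = map P [0..<n], fwd = map (\<lambda>l. R l j (dual (hs j) l)) [0..<n],
     bwd = map (\<lambda>l. R l j (dual (hs j) (Suc l))) [0..<n]\<rparr>"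

lemma zlen_glued [simp]: "zlen (glued n hs P R j) = n"
  by (simp add: glued_def zlen_def)

lemma sobj_glued [simp]: "l < n \<Longrightarrow> sobj (glued n hs P R j) ! l = P l"
  by (simp add: glued_def)

lemma glued_sliced:
  assumes hs: "sing_cocone n hs" and b: "\<And>l. l < n \<Longrightarrow> block_cocone hs l (P l) (S l) (R l)"
    and j: "j \<in> Obj J"
  shows "sliced_cocone (glued n hs P R j) hs S R"
  unfolding sliced_cocone_def zlen_glued
proof (intro conjI ballI allI impI)
  let ?A = "glued n hs P R j"
  have le: "dual (hs j) l \<le> dual (hs j) (Suc l)" for l
    using sing_cocone_dual_le(2)[OF hs j] by simp
  have R: "R l j (dual (hs j) l) \<in> Hom C (robj (Z j) ! dual (hs j) l) (P l)"
    "R l j (dual (hs j) (Suc l)) \<in> Hom C (robj (Z j) ! dual (hs j) (Suc l)) (P l)"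
    if "l < n" for l
    using block_coconeD(5)[OF b[OF that] j] le by auto
  have ends: "robj ?A ! l = robj (Z j) ! dual (hs j) l" if "l \<le> n" for l
    using that unfolding glued_def by (simp del: upt_Suc)
  have arrs: "fwd ?A ! l = R l j (dual (hs j) l)" "bwd ?A ! l = R l j (dual (hs j) (Suc l))"
    if "l < n" for l
    using that by (simp_all add: glued_def)
  show "is_zigzag C ?A"
    unfolding is_zigzag_def zlen_glued
  proof (intro conjI allI impI)
    show "set (robj ?A) \<subseteq> Obj C"
      using zigzag_simps(5)[OF Z_zigzag[OF j]] sing_cocone_dual_le(1)[OF hs j]
      by (auto simp: glued_def simp del: upt_Suc)
    show "set (sobj ?A) \<subseteq> Obj C"
      using block_coconeD(1)[OF b] by (auto simp: glued_def)
    show "fwd ?A ! i \<in> Hom C (robj ?A ! i) (sobj ?A ! i)"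
      "bwd ?A ! i \<in> Hom C (robj ?A ! (i + 1)) (sobj ?A ! i)" if "i < n" for i
      using that R ends arrs by simp_all
  qed (simp_all add: glued_def)
  show "sing_cocone n hs" by (rule hs)
  show "block_cocone hs l (sobj ?A ! l) (S l) (R l)" if "l < n" for l
    using b[OF that] that by simp
  fix j' l assume j': "j' \<in> Obj J"
  show "robj ?A ! l = robj (Z j') ! dual (hs j') l" if "l \<le> n"
    using ends[OF that] robj_dual_const[OF hs j j'] by simp
  show "fwd ?A ! l = R l j' (dual (hs j') l)" "bwd ?A ! l = R l j' (dual (hs j') (Suc l))"
    if "l < n"
    using arrs[OF that] block_ends_const[OF hs b[OF that] j j'] by simp_all
qed


section \<open>Morphisms of cocones\<close>

text \<open>If \<open>hs'\<close> factors through \<open>hs\<close> by \<open>u\<close>, the \<open>k\<close>-th block for \<open>hs\<close> lies inside the block \<open>u(k)\<close> for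
  \<open>hs'\<close>; a cocone on the larger block restricts to the smaller one with unchanged indices.\<close>

lemma dual_refine:
  assumes hs: "sing_cocone n hs" and j: "j \<in> Obj J"
    and u: "is_mono_map u" "mdom u = n" and eq: "mono_comp u (hs j) = hs' j"
  shows "dual (hs' j) l = dual (hs j) (dual u l)"
    and "k < n \<Longrightarrow> dual (hs' j) (vals u ! k) \<le> dual (hs j) k"
    and "k < n \<Longrightarrow> dual (hs j) (Suc k) \<le> dual (hs' j) (Suc (vals u ! k))"
proof -
  note h = sing_coconeD[OF hs j]
  have *: "dual (hs' j) l = dual (hs j) (dual u l)" for l
    unfolding eq[symmetric] using u h by (intro dual_mono_comp) auto
  then show "dual (hs' j) l = dual (hs j) (dual u l)" .
  assume "k < n"
  then have "dual u (vals u ! k) \<le> k" "Suc k \<le> dual u (Suc (vals u ! k))"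
    using fibre_iff[OF u(1), of k "vals u ! k"] u(2) by auto
  then show "dual (hs' j) (vals u ! k) \<le> dual (hs j) k"
    "dual (hs j) (Suc k) \<le> dual (hs' j) (Suc (vals u ! k))"
    unfolding * by (auto intro: dual_mono[OF h(1)])
qed

lemma block_cocone_refine:
  assumes hs: "sing_cocone n hs" and u: "is_mono_map u" "mdom u = n"
    and eq: "\<And>j. j \<in> Obj J \<Longrightarrow> mono_comp u (hs j) = hs' j" and k: "k < n"
    and b: "block_cocone hs' (vals u ! k) p S R"
  shows "block_cocone hs k p S R"
proof -
  note B = block_coconeD[OF b]
  have r: "dual (hs' j) (vals u ! k) \<le> dual (hs j) k"
    "dual (hs j) (Suc k) \<le> dual (hs' j) (Suc (vals u ! k))" if "j \<in> Obj J" for j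
    using dual_refine(2,3)[where hs = hs and hs' = hs', OF hs that u eq[OF that] k] by auto
  show ?thesis
    unfolding block_cocone_def
  proof (intro conjI ballI allI impI)
    show "p \<in> Obj C" by (rule B)
  next
    fix j i assume j: "j \<in> Obj J" and "dual (hs j) k \<le> i \<and> i < dual (hs j) (Suc k)"
    then have i: "dual (hs' j) (vals u ! k) \<le> i" "i < dual (hs' j) (Suc (vals u ! k))"
      using r[OF j] by linarith+
    show "S j i \<in> Hom C (sobj (Z j) ! i) p" "Comp C (S j i) (fwd (Z j) ! i) = R j i"
      "Comp C (S j i) (bwd (Z j) ! i) = R j (Suc i)"
      using B(2-4)[OF j i] by auto
  next
    fix j i assume j: "j \<in> Obj J" and "dual (hs j) k \<le> i \<and> i \<le> dual (hs j) (Suc k)"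
    then have i: "dual (hs' j) (vals u ! k) \<le> i" "i \<le> dual (hs' j) (Suc (vals u ! k))"
      using r[OF j] by linarith+
    show "R j i \<in> Hom C (robj (Z j) ! i) p" using B(5)[OF j i] .
  next
    fix \<sigma> i assume \<sigma>: "\<sigma> \<in> Arr J" and "dual (hs (Dom J \<sigma>)) k \<le> i \<and> i < dual (hs (Dom J \<sigma>)) (Suc k)"
    then have i: "dual (hs' (Dom J \<sigma>)) (vals u ! k) \<le> i" "i < dual (hs' (Dom J \<sigma>)) (Suc (vals u ! k))"
      using r[OF J.dom_obj[OF \<sigma>]] by linarith+
    show "Comp C (S (Cod J \<sigma>) (vals (sing \<sigma>) ! i)) (zcomp (FArr D \<sigma>) ! i) = S (Dom J \<sigma>) i"
      using B(6)[OF \<sigma> i] .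
  next
    fix \<sigma> i assume \<sigma>: "\<sigma> \<in> Arr J" and "dual (hs (Cod J \<sigma>)) k \<le> i \<and> i \<le> dual (hs (Cod J \<sigma>)) (Suc k)"
    then have i: "dual (hs' (Cod J \<sigma>)) (vals u ! k) \<le> i" "i \<le> dual (hs' (Cod J \<sigma>)) (Suc (vals u ! k))"
      using r[OF J.cod_obj[OF \<sigma>]] by linarith+
    show "R (Dom J \<sigma>) (zreg (FArr D \<sigma>) i) = R (Cod J \<sigma>) i" using B(7)[OF \<sigma> i] .
  qed
qed

text \<open>Compatibility of a morphism \<open>x\<close> between apexes with two block cocones, split by the kind of
  vertex because the legs of a zigzag map record only the singular half.\<close>

definition sing_compat where
  "sing_compat hs k x S S' \<longleftrightarrow>
     (\<forall>j\<in>Obj J. \<forall>i. dual (hs j) k \<le> i \<and> i < dual (hs j) (Suc k) \<longrightarrow> Comp C x (S j i) = S' j i)"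

definition reg_compat where
  "reg_compat hs k x R R' \<longleftrightarrow>
     (\<forall>j\<in>Obj J. \<forall>i. dual (hs j) k \<le> i \<and> i \<le> dual (hs j) (Suc k) \<longrightarrow> Comp C x (R j i) = R' j i)"

text \<open>If some \<open>D(w)\<close> has a singular object in the block, compatibility at singular vertices is
  enough.  For \<open>j\<close> whose part of the block is a single regular object there is no singular object
  to factor through, and the value there is transported from \<open>w\<close> along \<open>J\<close>.\<close>

lemma reg_compat_if_sing_compat:
  assumes hs: "sing_cocone n hs" and b: "block_cocone hs k p S R" and b': "block_cocone hs k p' S' R'"
    and x: "x \<in> Hom C p p'" and w: "w \<in> Obj J" "dual (hs w) k < dual (hs w) (Suc k)"
    and s: "sing_compat hs k x S S'"
  shows "reg_compat hs k x R R'"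
proof -
  note B = block_coconeD[OF b] and B' = block_coconeD[OF b']
  have ne: "Comp C x (R j i) = R' j i"
    if j: "j \<in> Obj J" and i: "dual (hs j) k \<le> i" "i \<le> dual (hs j) (Suc k)"
      and lt: "dual (hs j) k < dual (hs j) (Suc k)" for j i
  proof (cases "i < dual (hs j) (Suc k)")
    case True
    have iN: "i < N j" using True sing_cocone_dual_le(1)[OF hs j, of "Suc k"] by linarith
    have "Comp C x (R j i) = Comp C x (Comp C (S j i) (fwd (Z j) ! i))"
      using B(3)[OF j i(1) True] by simp
    also have "\<dots> = Comp C (Comp C x (S j i)) (fwd (Z j) ! i)"
      by (rule comp_assoc[OF zigzag_simps(7)[OF Z_zigzag[OF j] iN] B(2)[OF j i(1) True] x])
    also have "\<dots> = R' j i"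
      using s j i True B'(3)[OF j i(1) True] by (simp add: sing_compat_def)
    finally show ?thesis .
  next
    case False
    then obtain m where m: "i = Suc m" "dual (hs j) k \<le> m" "m < dual (hs j) (Suc k)"
      using i lt by (cases i) auto
    have mN: "m < N j" using m sing_cocone_dual_le(1)[OF hs j, of "Suc k"] by linarith
    have "Comp C x (R j i) = Comp C x (Comp C (S j m) (bwd (Z j) ! m))"
      using B(4)[OF j m(2,3)] m(1) by simp
    also have "\<dots> = Comp C (Comp C x (S j m)) (bwd (Z j) ! m)"
      by (rule comp_assoc[OF zigzag_simps(8)[OF Z_zigzag[OF j] mN] B(2)[OF j m(2,3)] x])
    also have "\<dots> = R' j i"
      using s j m B'(4)[OF j m(2,3)] by (simp add: sing_compat_def)
    finally show ?thesis .
  qed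
  show ?thesis
    unfolding reg_compat_def
  proof (intro ballI allI impI)
    fix j i assume j: "j \<in> Obj J" and i: "dual (hs j) k \<le> i \<and> i \<le> dual (hs j) (Suc k)"
    show "Comp C x (R j i) = R' j i"
    proof (cases "dual (hs j) k < dual (hs j) (Suc k)")
      case True
      then show ?thesis using ne[OF j] i by simp
    next
      case False
      then have "i = dual (hs j) k" using i by linarith
      then show ?thesis
        using ne[OF w(1) _ _ w(2), of "dual (hs w) k"] w(2)
          block_ends_const(1)[OF hs b j w(1)] block_ends_const(1)[OF hs b' j w(1)] by simp
    qed
  qed
qed

text \<open>Zigzag maps out of the apex of a cocone that carry its legs to those of another cocone are
  the same as a monotone map together with a compatible morphism for each block.\<close>

lemma mediating_zmap:
  assumes A: "sliced_cocone A hs S R" and A': "sliced_cocone A' hs' S' R'"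
    and u: "is_mono_map u" "mdom u = zlen A" "mcod u = zlen A'"
    and uhs: "\<And>j. j \<in> Obj J \<Longrightarrow> mono_comp u (hs j) = hs' j"
    and v: "length v = zlen A" "\<And>k. k < zlen A \<Longrightarrow> v ! k \<in> Hom C (sobj A ! k) (sobj A' ! (vals u ! k))"
    and vS: "\<And>k. k < zlen A \<Longrightarrow> sing_compat hs k (v ! k) (S k) (S' (vals u ! k))"
    and vR: "\<And>k. k < zlen A \<Longrightarrow> reg_compat hs k (v ! k) (R k) (R' (vals u ! k))"
  defines "g \<equiv> \<lparr>zdom = A, zcod = A', zsing = u, zcomp = v\<rparr>"
  shows "is_zmap C g" and "j \<in> Obj J \<Longrightarrow> zmap_comp C g (leg A hs S j) = leg A' hs' S' j"
proof -
  note B = sliced_coconeD[OF A] and B' = sliced_coconeD[OF A']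
  \<comment> \<open>The regular objects and arrows of both apexes are those of a single index.\<close>
  obtain j0 where j0: "j0 \<in> Obj J" using ex_obj by blast
  have d: "dual (hs' j0) l = dual (hs j0) (dual u l)" for l
    by (rule dual_refine(1)[where hs' = hs', OF B(2) j0 u(1,2) uhs[OF j0]])
  have ule: "dual u l \<le> zlen A" for l using dual_le_mdom[of u l] u(2) by simp
  have le: "dual (hs j0) k \<le> dual (hs j0) (Suc k)" for k
    using sing_cocone_dual_le(2)[OF B(2) j0] by simp
  show "is_zmap C g"
  proof (rule is_zmapI[where R = "\<lambda>l k. R' l j0 (dual (hs j0) k)"], unfold g_def zmap.simps)
    show "robj A' ! l = robj A ! zreg \<lparr>zdom = A, zcod = A', zsing = u, zcomp = v\<rparr> l"
      if "l \<le> zlen A'" for l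
      using B'(4)[OF j0 that] B(4)[OF j0 ule] by (simp add: zreg_def d)
    show "R' l j0 (dual (hs j0) (zreg \<lparr>zdom = A, zcod = A', zsing = u, zcomp = v\<rparr> l)) = fwd A' ! l"
      "R' l j0 (dual (hs j0) (zreg \<lparr>zdom = A, zcod = A', zsing = u, zcomp = v\<rparr> (Suc l))) = bwd A' ! l"
      if "l < zlen A'" for l
      using B'(5,6)[OF j0 that] by (simp_all add: zreg_def d)
    show "Comp C (v ! k) (fwd A ! k) = R' l j0 (dual (hs j0) k)"
      "Comp C (v ! k) (bwd A ! k) = R' l j0 (dual (hs j0) (Suc k))"
      if "l < zlen A'" "k < zlen A" "vals u ! k = l" for l k
      using vR[OF that(2)] B(5,6)[OF j0 that(2)] that(3) j0 le[of k]
      by (simp_all add: reg_compat_def)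
  qed (use B(1) B'(1) u v in simp_all)
  assume j: "j \<in> Obj J"
  note h = sing_coconeD[OF B(2) j]
  have "Comp C (v ! (vals (hs j) ! i)) (S (vals (hs j) ! i) j i) = S' (vals (hs' j) ! i) j i"
    if i: "i < N j" for i
  proof -
    note w = sliced_cocone_vals[OF A j i]
    have "vals (hs' j) ! i = vals u ! (vals (hs j) ! i)"
      using uhs[OF j, symmetric] h(2) i by simp
    then show ?thesis using vS[OF w(1)] w(2,3) j by (simp add: sing_compat_def)
  qed
  then show "zmap_comp C g (leg A hs S j) = leg A' hs' S' j"
    using uhs[OF j] by (simp add: g_def zmap_comp_def leg_def)
qed

lemma mediating_zmapD:
  assumes A: "sliced_cocone A hs S R"
    and g: "is_zmap C g" "zdom g = A" "zcod g = A'"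
    and eq: "\<forall>j\<in>Obj J. zmap_comp C g (leg A hs S j) = leg A' hs' S' j"
  shows "is_mono_map (zsing g)" "mdom (zsing g) = zlen A" "mcod (zsing g) = zlen A'"
    "\<And>j. j \<in> Obj J \<Longrightarrow> mono_comp (zsing g) (hs j) = hs' j"
    "\<And>k. k < zlen A \<Longrightarrow> zcomp g ! k \<in> Hom C (sobj A ! k) (sobj A' ! (vals (zsing g) ! k))"
    "\<And>k. k < zlen A \<Longrightarrow> sing_compat hs k (zcomp g ! k) (S k) (S' (vals (zsing g) ! k))"
proof -
  show "is_mono_map (zsing g)" "mdom (zsing g) = zlen A" "mcod (zsing g) = zlen A'"
    using zmap_simps(3-5)[OF g(1)] g by auto
  show "zcomp g ! k \<in> Hom C (sobj A ! k) (sobj A' ! (vals (zsing g) ! k))" if "k < zlen A" for k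
    using zmap_simps(7)[OF g(1)] g that by auto
  show c: "mono_comp (zsing g) (hs j) = hs' j" if "j \<in> Obj J" for j
    using arg_cong[OF bspec[OF eq that], of zsing] by (simp add: zmap_comp_def)
  show "sing_compat hs k (zcomp g ! k) (S k) (S' (vals (zsing g) ! k))" if k: "k < zlen A" for k
    unfolding sing_compat_def
  proof (intro ballI allI impI)
    fix j i assume j: "j \<in> Obj J" and i: "dual (hs j) k \<le> i \<and> i < dual (hs j) (Suc k)"
    note hs = sliced_coconeD(2)[OF A]
    have iN: "i < N j" using i sing_cocone_dual_le(1)[OF hs j, of "Suc k"] by linarith
    have hk: "vals (hs j) ! i = k" using sing_cocone_fibre[OF hs j iN] i by simp
    have hk': "vals (hs' j) ! i = vals (zsing g) ! k"
      using c[OF j, symmetric] hk sing_coconeD(2)[OF hs j] iN by simp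
    have "zcomp (zmap_comp C g (leg A hs S j)) ! i = zcomp (leg A' hs' S' j) ! i"
      using eq j by simp
    then show "Comp C (zcomp g ! k) (S k j i) = S' (vals (zsing g) ! k) j i"
      using iN hk hk' by (simp add: zmap_comp_def)
  qed
qed


section \<open>Colimits\<close>

definition sing_colimit :: "nat \<Rightarrow> ('j \<Rightarrow> mono_map) \<Rightarrow> bool" where
  "sing_colimit c cs \<longleftrightarrow> sing_cocone c cs \<and>
     (\<forall>n hs. sing_cocone n hs \<longrightarrow>
        (\<exists>!u. (is_mono_map u \<and> mdom u = c \<and> mcod u = n) \<and>
              (\<forall>j\<in>Obj J. mono_comp u (cs j) = hs j)))"

lemma sing_colimit_iff:
  "is_colimit Delta (ftor_diagram J (ftor_comp Sing D)) c cs \<longleftrightarrow> sing_colimit c cs"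
  unfolding is_colimit_def sing_cocone_iff sing_colimit_def Hom_Delta_iff
  by (simp add: ftor_diagram_def)

definition block_colimit ::
  "('j \<Rightarrow> mono_map) \<Rightarrow> nat \<Rightarrow> 'o \<Rightarrow> ('j \<Rightarrow> nat \<Rightarrow> 'm) \<Rightarrow> ('j \<Rightarrow> nat \<Rightarrow> 'm) \<Rightarrow> bool" where
  "block_colimit hs l p S R \<longleftrightarrow> block_cocone hs l p S R \<and>
     (\<forall>p' S' R'. block_cocone hs l p' S' R' \<longrightarrow>
        (\<exists>!x. x \<in> Hom C p p' \<and> sing_compat hs l x S S' \<and> reg_compat hs l x R R'))"

lemma piece_colimit_iff:
  assumes hs: "sing_cocone n hs"
  shows "is_colimit C (deconstruction C J (piece J D hs l)) p (glue hs l S R) \<longleftrightarrow>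
    block_colimit hs l p S R"
proof -
  let ?G = "deconstruction C J (piece J D hs l)"
  have compat: "(\<forall>v\<in>Verts ?G. Comp C x (glue hs l S R v) = glue hs l S' R' v) \<longleftrightarrow>
      sing_compat hs l x S S' \<and> reg_compat hs l x R R'" for x S' R'
  proof -
    have "(\<forall>v\<in>Verts ?G. Comp C x (glue hs l S R v) = glue hs l S' R' v) \<longleftrightarrow>
      (\<forall>j\<in>Obj J. \<forall>i<zlen (FObj (piece J D hs l) j).
         Comp C x (glue hs l S R (SVert j i)) = glue hs l S' R' (SVert j i)) \<and>
      (\<forall>j\<in>Obj J. \<forall>i\<le>zlen (FObj (piece J D hs l) j).
         Comp C x (glue hs l S R (RVert j i)) = glue hs l S' R' (RVert j i))"
      unfolding deconstruction_def diagram.simps by blast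
    also have "\<dots> \<longleftrightarrow> sing_compat hs l x S S' \<and> reg_compat hs l x R R'"
      unfolding sing_compat_def reg_compat_def
    proof (intro arg_cong2[where f = "(\<and>)"] ball_cong refl)
      fix j assume j: "j \<in> Obj J"
      show "(\<forall>i<zlen (FObj (piece J D hs l) j).
           Comp C x (glue hs l S R (SVert j i)) = glue hs l S' R' (SVert j i)) \<longleftrightarrow>
         (\<forall>i. dual (hs j) l \<le> i \<and> i < dual (hs j) (Suc l) \<longrightarrow> Comp C x (S j i) = S' j i)"
        by (subst all_less_shift[symmetric]) (simp add: piece_obj(2)[OF hs j] glue_def)
      show "(\<forall>i\<le>zlen (FObj (piece J D hs l) j).
           Comp C x (glue hs l S R (RVert j i)) = glue hs l S' R' (RVert j i)) \<longleftrightarrow>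
         (\<forall>i. dual (hs j) l \<le> i \<and> i \<le> dual (hs j) (Suc l) \<longrightarrow> Comp C x (R j i) = R' j i)"
        using sing_cocone_dual_le(2)[OF hs j, of l "Suc l"]
        by (subst all_le_shift[symmetric]) (simp_all add: piece_obj(2)[OF hs j] glue_def)
    qed
    finally show ?thesis .
  qed
  have all: "(\<forall>q \<psi>. P q \<psi>) \<longleftrightarrow> (\<forall>q S' R'. P q (glue hs l S' R'))" for P :: "'o \<Rightarrow> _ \<Rightarrow> bool"
  proof (intro iffI allI)
    fix q \<psi> assume "\<forall>q S' R'. P q (glue hs l S' R')"
    then have "P q (glue hs l (\<lambda>j i. \<psi> (SVert j (i - dual (hs j) l)))
        (\<lambda>j i. \<psi> (RVert j (i - dual (hs j) l))))" by blast
    then show "P q \<psi>" unfolding glue_unglue .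
  qed blast
  show ?thesis
    unfolding is_colimit_def block_colimit_def piece_cocone_iff[OF hs, symmetric] compat[symmetric]
    by (rule arg_cong2[where f = "(\<and>)", OF refl all])
qed

lemma zigzag_colimit_iff:
  "is_colimit (Zigzags C) (ftor_diagram J D) A \<psi> \<longleftrightarrow>
     is_cocone (Zigzags C) (ftor_diagram J D) A \<psi> \<and>
     (\<forall>A' \<psi>'. is_cocone (Zigzags C) (ftor_diagram J D) A' \<psi>' \<longrightarrow>
        (\<exists>!g. (is_zmap C g \<and> zdom g = A \<and> zcod g = A') \<and>
              (\<forall>j\<in>Obj J. zmap_comp C g (\<psi> j) = \<psi>' j)))"
  unfolding is_colimit_def by (simp add: Zigzags_def ftor_diagram_def Hom_def)

text \<open>The legs of a colimit in finite ordinals are jointly surjective: otherwise the two monotone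
  maps that skip \<open>Suc k\<close>, respectively \<open>k\<close>, would agree on all legs.\<close>

lemma sing_colimit_surj:
  assumes c: "sing_colimit c cs" and k: "k < c"
  shows "\<exists>j\<in>Obj J. dual (cs j) k < dual (cs j) (Suc k)"
proof (rule ccontr)
  assume contra: "\<not> ?thesis"
  have cs: "sing_cocone c cs" using c by (simp add: sing_colimit_def)
  define u where "u P = \<lparr>vals = map (\<lambda>i. if P i then i else Suc i) [0..<c], mcod = Suc c\<rparr>" for P
  have u: "mdom (u P) = c" "mcod (u P) = Suc c" "\<And>i. i < c \<Longrightarrow> vals (u P) ! i = (if P i then i else Suc i)"
    for P by (simp_all add: u_def mdom_def)
  let ?u1 = "u (\<lambda>i. i \<le> k)" and ?u2 = "u (\<lambda>i. i < k)"
  have m: "is_mono_map ?u1" "is_mono_map ?u2"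
    by (auto intro!: is_mono_mapI simp: u)
  have eq: "mono_comp ?u1 (cs j) = mono_comp ?u2 (cs j)" if j: "j \<in> Obj J" for j
  proof (rule mono_map_eqI)
    fix i assume "i < mdom (mono_comp ?u2 (cs j))"
    then have i: "i < N j" using sing_coconeD(2)[OF cs j] by simp
    have "vals (cs j) ! i \<noteq> k" using sing_cocone_fibre[OF cs j i] contra j by auto
    moreover have "vals (cs j) ! i < c"
      using vals_less_mcod[of "cs j" i] sing_coconeD[OF cs j] i by simp
    ultimately show "vals (mono_comp ?u1 (cs j)) ! i = vals (mono_comp ?u2 (cs j)) ! i"
      using sing_coconeD(2)[OF cs j] i by (simp add: u)
  qed (simp_all add: u)
  have "sing_cocone (Suc c) (\<lambda>j. mono_comp ?u1 (cs j))"
    unfolding sing_cocone_def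
  proof (intro conjI ballI)
    fix \<sigma> assume \<sigma>: "\<sigma> \<in> Arr J"
    show "mono_comp (mono_comp ?u1 (cs (Cod J \<sigma>))) (sing \<sigma>) = mono_comp ?u1 (cs (Dom J \<sigma>))"
      using D_sing[OF \<sigma>] sing_coconeD[OF cs J.cod_obj[OF \<sigma>]] cs \<sigma>
      by (subst mono_comp_assoc) (simp_all add: sing_cocone_def)
  qed (use sing_coconeD[OF cs] m in \<open>auto intro!: is_mono_map_comp simp: u\<close>)
  then have "\<exists>!v. (is_mono_map v \<and> mdom v = c \<and> mcod v = Suc c) \<and>
      (\<forall>j\<in>Obj J. mono_comp v (cs j) = mono_comp ?u1 (cs j))"
    using c unfolding sing_colimit_def by blast
  then have "?u1 = ?u2"
    by (rule unique_eq) (use m eq u(1,2) in auto)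
  then have "vals ?u1 ! k = vals ?u2 ! k" by simp
  then show False using k by (simp add: u)
qed


text \<open>A cocone with apex \<open>A'\<close> gives the monotone part \<open>u\<close> of the mediating map.  Each block of \<open>A\<close> lies
  inside a block of \<open>A'\<close>, so restricting the cocone there and using the colimit property of the block
  gives the singular components.\<close>

lemma sliced_colimit:
  assumes A: "sliced_cocone A cs S R" and c: "sing_colimit (zlen A) cs"
    and p: "\<And>k. k < zlen A \<Longrightarrow> block_colimit cs k (sobj A ! k) (S k) (R k)"
  shows "is_colimit (Zigzags C) (ftor_diagram J D) A (leg A cs S)"
  unfolding zigzag_colimit_iff
proof (intro conjI allI impI)
  show "is_cocone (Zigzags C) (ftor_diagram J D) A (leg A cs S)"
    by (rule sliced_cocone_is_cocone[OF A])
  fix A' \<psi> assume coc: "is_cocone (Zigzags C) (ftor_diagram J D) A' \<psi>"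
  define hs S' R' where "hs = (\<lambda>j. zsing (\<psi> j))" and "S' = (\<lambda>(l::nat) j i. zcomp (\<psi> j) ! i)"
    and "R' = (\<lambda>l j i. reg_arrow C (\<psi> j) l i)"
  have A': "sliced_cocone A' hs S' R'" and \<psi>: "\<And>j. j \<in> Obj J \<Longrightarrow> \<psi> j = leg A' hs S' j"
    using cocone_sliced[OF coc] unfolding hs_def S'_def R'_def by blast+
  note B = sliced_coconeD[OF A] and B' = sliced_coconeD[OF A']
  have "\<exists>!u. (is_mono_map u \<and> mdom u = zlen A \<and> mcod u = zlen A') \<and>
      (\<forall>j\<in>Obj J. mono_comp u (cs j) = hs j)"
    using c B'(2) unfolding sing_colimit_def by blast
  then obtain u where u: "is_mono_map u" "mdom u = zlen A" "mcod u = zlen A'"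
    and uhs: "\<And>j. j \<in> Obj J \<Longrightarrow> mono_comp u (cs j) = hs j"
    and uu: "\<And>u'. is_mono_map u' \<Longrightarrow> mdom u' = zlen A \<Longrightarrow> mcod u' = zlen A' \<Longrightarrow>
      (\<And>j. j \<in> Obj J \<Longrightarrow> mono_comp u' (cs j) = hs j) \<Longrightarrow> u' = u"
    by (elim ex1E) blast
  have blk: "block_cocone cs k (sobj A' ! (vals u ! k)) (S' (vals u ! k)) (R' (vals u ! k))"
    if k: "k < zlen A" for k
  proof (rule block_cocone_refine[OF B(2) u(1,2) uhs k])
    have "vals u ! k < zlen A'" using vals_less_mcod[OF u(1)] u(2,3) k by simp
    then show "block_cocone hs (vals u ! k) (sobj A' ! (vals u ! k)) (S' (vals u ! k)) (R' (vals u ! k))"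
      by (rule B'(3))
  qed
  have ex1: "\<exists>!x. x \<in> Hom C (sobj A ! k) (sobj A' ! (vals u ! k)) \<and>
      sing_compat cs k x (S k) (S' (vals u ! k)) \<and> reg_compat cs k x (R k) (R' (vals u ! k))"
    if "k < zlen A" for k
    using p[OF that] blk[OF that] unfolding block_colimit_def by blast
  define v where "v = map (\<lambda>k. THE x. x \<in> Hom C (sobj A ! k) (sobj A' ! (vals u ! k)) \<and>
      sing_compat cs k x (S k) (S' (vals u ! k)) \<and> reg_compat cs k x (R k) (R' (vals u ! k))) [0..<zlen A]"
  have v: "length v = zlen A" by (simp add: v_def)
  have vk: "v ! k \<in> Hom C (sobj A ! k) (sobj A' ! (vals u ! k))"
    "sing_compat cs k (v ! k) (S k) (S' (vals u ! k))"
    "reg_compat cs k (v ! k) (R k) (R' (vals u ! k))" if "k < zlen A" for k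
    using theI'[OF ex1[OF that]] that by (simp_all add: v_def)
  define g where "g = \<lparr>zdom = A, zcod = A', zsing = u, zcomp = v\<rparr>"
  have g: "is_zmap C g" "\<And>j. j \<in> Obj J \<Longrightarrow> zmap_comp C g (leg A cs S j) = leg A' hs S' j"
    using mediating_zmap[OF A A' u uhs v vk] unfolding g_def by blast+
  show "\<exists>!g. (is_zmap C g \<and> zdom g = A \<and> zcod g = A') \<and>
      (\<forall>j\<in>Obj J. zmap_comp C g (leg A cs S j) = \<psi> j)"
  proof (rule ex1I[of _ g])
    show "(is_zmap C g \<and> zdom g = A \<and> zcod g = A') \<and>
        (\<forall>j\<in>Obj J. zmap_comp C g (leg A cs S j) = \<psi> j)"
      using g \<psi> by (simp add: g_def)
    fix g' assume asm: "(is_zmap C g' \<and> zdom g' = A \<and> zcod g' = A') \<and>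
        (\<forall>j\<in>Obj J. zmap_comp C g' (leg A cs S j) = \<psi> j)"
    then have g': "is_zmap C g'" "zdom g' = A" "zcod g' = A'"
      and eq: "\<forall>j\<in>Obj J. zmap_comp C g' (leg A cs S j) = leg A' hs S' j"
      using \<psi> by auto
    note M = mediating_zmapD[OF A g' eq]
    have su: "zsing g' = u" by (rule uu[OF M(1-4)])
    show "g' = g"
    proof (rule zmap_eqI[OF g'(1) g(1)])
      fix k assume "k < zlen (zdom g')"
      then have k: "k < zlen A" by (simp add: g')
      obtain w where w: "w \<in> Obj J" "dual (cs w) k < dual (cs w) (Suc k)"
        using sing_colimit_surj[OF c k] by blast
      have "reg_compat cs k (zcomp g' ! k) (R k) (R' (vals u ! k))"
        using reg_compat_if_sing_compat[OF B(2) B(3)[OF k] blk[OF k] _ w] M(5,6)[OF k] su by simp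
      then have "zcomp g' ! k = v ! k"
        by (intro unique_eq[OF ex1[OF k]]) (use M(5,6)[OF k] su vk[OF k] in simp_all)
      then show "zcomp g' ! k = zcomp g ! k" by (simp add: g_def)
    qed (simp_all add: g' su, simp_all add: g_def)
  qed
qed

text \<open>Every cocone of monotone maps has such blocks, so it lifts to a cocone of zigzag maps; they also
  fill up a cocone around a single block that is under test.\<close>

lemma terminal_block:
  assumes hs: "sing_cocone n hs" and t: "t \<in> Obj C"
    and tm: "\<And>x. x \<in> Obj C \<Longrightarrow> tm x \<in> Hom C x t" "\<And>x f. f \<in> Hom C x t \<Longrightarrow> f = tm x"
  shows "block_cocone hs l t (\<lambda>j i. tm (sobj (Z j) ! i)) (\<lambda>j i. tm (robj (Z j) ! i))"
  unfolding block_cocone_def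
proof (intro conjI ballI allI impI)
  show "t \<in> Obj C" by (rule t)
next
  fix j i assume j: "j \<in> Obj J" and i: "dual (hs j) l \<le> i \<and> i < dual (hs j) (Suc l)"
  then have iN: "i < N j" using sing_cocone_dual_le(1)[OF hs j, of "Suc l"] by linarith
  note z = zigzag_simps[OF Z_zigzag[OF j]]
  show "tm (sobj (Z j) ! i) \<in> Hom C (sobj (Z j) ! i) t" by (rule tm(1)[OF z(6)[OF iN]])
  show "Comp C (tm (sobj (Z j) ! i)) (fwd (Z j) ! i) = tm (robj (Z j) ! i)"
    by (rule tm(2)[OF comp_hom[OF z(7)[OF iN] tm(1)[OF z(6)[OF iN]]]])
  show "Comp C (tm (sobj (Z j) ! i)) (bwd (Z j) ! i) = tm (robj (Z j) ! Suc i)"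
    by (rule tm(2)[OF comp_hom[OF z(8)[OF iN] tm(1)[OF z(6)[OF iN]]]])
next
  fix j i assume j: "j \<in> Obj J" and i: "dual (hs j) l \<le> i \<and> i \<le> dual (hs j) (Suc l)"
  then have "i \<le> N j" using sing_cocone_dual_le(1)[OF hs j, of "Suc l"] by linarith
  then show "tm (robj (Z j) ! i) \<in> Hom C (robj (Z j) ! i) t"
    by (intro tm(1) zigzag_simps(5)[OF Z_zigzag[OF j]])
next
  fix \<sigma> i assume \<sigma>: "\<sigma> \<in> Arr J" and i: "dual (hs (Dom J \<sigma>)) l \<le> i \<and> i < dual (hs (Dom J \<sigma>)) (Suc l)"
  then have iN: "i < N (Dom J \<sigma>)"
    using sing_cocone_dual_le(1)[OF hs J.dom_obj[OF \<sigma>], of "Suc l"] by linarith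
  then have "vals (sing \<sigma>) ! i < N (Cod J \<sigma>)"
    using vals_less_mcod[OF D_sing(1)[OF \<sigma>]] D_sing[OF \<sigma>] by simp
  then have "tm (sobj (Z (Cod J \<sigma>)) ! (vals (sing \<sigma>) ! i)) \<in>
      Hom C (sobj (Z (Cod J \<sigma>)) ! (vals (sing \<sigma>) ! i)) t"
    by (intro tm(1) zigzag_simps(6)[OF Z_zigzag[OF J.cod_obj[OF \<sigma>]]])
  moreover have "zcomp (FArr D \<sigma>) ! i \<in>
      Hom C (sobj (Z (Dom J \<sigma>)) ! i) (sobj (Z (Cod J \<sigma>)) ! (vals (sing \<sigma>) ! i))"
    using zmap_simps(7)[OF D_zmap(1)[OF \<sigma>], of i] D_zmap(2,3)[OF \<sigma>] iN by simp
  ultimately show "Comp C (tm (sobj (Z (Cod J \<sigma>)) ! (vals (sing \<sigma>) ! i))) (zcomp (FArr D \<sigma>) ! i) =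
      tm (sobj (Z (Dom J \<sigma>)) ! i)"
    by (intro tm(2) comp_hom)
next
  fix \<sigma> i assume \<sigma>: "\<sigma> \<in> Arr J" and i: "dual (hs (Cod J \<sigma>)) l \<le> i \<and> i \<le> dual (hs (Cod J \<sigma>)) (Suc l)"
  then have "i \<le> N (Cod J \<sigma>)"
    using sing_cocone_dual_le(1)[OF hs J.cod_obj[OF \<sigma>], of "Suc l"] by linarith
  then show "tm (robj (Z (Dom J \<sigma>)) ! zreg (FArr D \<sigma>) i) = tm (robj (Z (Cod J \<sigma>)) ! i)"
    using zmap_simps(8)[OF D_zmap(1)[OF \<sigma>], of i] D_zmap(2,3)[OF \<sigma>] by simp
qed

text \<open>The test cocones have one prescribed part, the monotone maps or a single block, and terminal
  apexes elsewhere, where mediating morphisms exist uniquely.  So the universal property of \<open>A\<close>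
  against them is the universal property of that one part of \<open>A\<close>.\<close>

lemma colimit_slices:
  assumes terminal: "has_terminal C" and A: "sliced_cocone A hs S R"
    and univ: "\<And>A' hs' S' R'. sliced_cocone A' hs' S' R' \<Longrightarrow>
      \<exists>!g. (is_zmap C g \<and> zdom g = A \<and> zcod g = A') \<and>
        (\<forall>j\<in>Obj J. zmap_comp C g (leg A hs S j) = leg A' hs' S' j)"
  shows "sing_colimit (zlen A) hs"
    and "k < zlen A \<Longrightarrow> block_colimit hs k (sobj A ! k) (S k) (R k)"
proof -
  note B = sliced_coconeD[OF A]
  obtain t tm where t: "t \<in> Obj C" and tm0: "\<And>x. x \<in> Obj C \<Longrightarrow> tm x \<in> Hom C x t"
    "\<And>x f. x \<in> Obj C \<Longrightarrow> f \<in> Hom C x t \<Longrightarrow> f = tm x"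
    using terminal unfolding has_terminal_def by metis
  have tm: "tm x \<in> Hom C x t" if "x \<in> Obj C" for x
    using tm0(1)[OF that] .
  have tu: "f = tm x" if "f \<in> Hom C x t" for x f
    using tm0(2)[OF _ that] dom_obj that by (auto simp: Hom_def)
  obtain j0 where j0: "j0 \<in> Obj J" using ex_obj by blast
  define TS TR where "TS = (\<lambda>j i. tm (sobj (Z j) ! i))" and "TR = (\<lambda>j i. tm (robj (Z j) ! i))"
  have tb: "block_cocone hs' l t TS TR" if "sing_cocone n hs'" for n hs' l
    unfolding TS_def TR_def by (rule terminal_block[OF that t tm tu])
  have tS: "sing_compat hs k (tm (sobj A ! k)) (S k) TS" if k: "k < zlen A" for k
    unfolding sing_compat_def TS_def
    by (intro ballI allI impI tu comp_hom[OF block_coconeD(2)[OF B(3)[OF k]]] tm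
        zigzag_simps(6)[OF B(1) k]) auto
  have tR: "reg_compat hs k (tm (sobj A ! k)) (R k) TR" if k: "k < zlen A" for k
    unfolding reg_compat_def TR_def
    by (intro ballI allI impI tu comp_hom[OF block_coconeD(5)[OF B(3)[OF k]]] tm
        zigzag_simps(6)[OF B(1) k]) auto
  show sc: "sing_colimit (zlen A) hs"
    unfolding sing_colimit_def
  proof (intro conjI allI impI B(2))
    fix n hs' assume hs': "sing_cocone n hs'"
    \<comment> \<open>A lift of \<open>hs'\<close> to zigzags: mediating maps into \<open>T\<close> are determined by their monotone part.\<close>
    define T where "T = glued n hs' (\<lambda>_. t) (\<lambda>_. TR) j0"
    have T: "sliced_cocone T hs' (\<lambda>_. TS) (\<lambda>_. TR)" and zT: "zlen T = n"
      and sT: "\<And>l. l < n \<Longrightarrow> sobj T ! l = t"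
      using glued_sliced[OF hs' tb[OF hs'] j0] unfolding T_def by simp_all
    obtain g where g: "is_zmap C g" "zdom g = A" "zcod g = T"
      and eq: "\<forall>j\<in>Obj J. zmap_comp C g (leg A hs S j) = leg T hs' (\<lambda>_. TS) j"
      using univ[OF T] by blast
    note M = mediating_zmapD[OF A g eq]
    show "\<exists>!u. (is_mono_map u \<and> mdom u = zlen A \<and> mcod u = n) \<and>
        (\<forall>j\<in>Obj J. mono_comp u (hs j) = hs' j)"
    proof (rule ex1I[of _ "zsing g"])
      show "(is_mono_map (zsing g) \<and> mdom (zsing g) = zlen A \<and> mcod (zsing g) = n) \<and>
          (\<forall>j\<in>Obj J. mono_comp (zsing g) (hs j) = hs' j)"
        using M(1-4) zT by simp
      fix u assume u: "(is_mono_map u \<and> mdom u = zlen A \<and> mcod u = n) \<and>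
          (\<forall>j\<in>Obj J. mono_comp u (hs j) = hs' j)"
      define v where "v = map (\<lambda>k. tm (sobj A ! k)) [0..<zlen A]"
      define g' where "g' = \<lparr>zdom = A, zcod = T, zsing = u, zcomp = v\<rparr>"
      have vk: "v ! k = tm (sobj A ! k)" if "k < zlen A" for k
        using that by (simp add: v_def)
      have hom: "v ! k \<in> Hom C (sobj A ! k) (sobj T ! (vals u ! k))" if "k < zlen A" for k
        using tm[OF zigzag_simps(6)[OF B(1) that]] sT[of "vals u ! k"] vals_less_mcod[of u k] u that
        by (simp add: vk)
      have g': "is_zmap C g'"
        "\<And>j. j \<in> Obj J \<Longrightarrow> zmap_comp C g' (leg A hs S j) = leg T hs' (\<lambda>_. TS) j"
        using mediating_zmap[OF A T, of u v] hom tS tR u zT vk unfolding g'_def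
        by (simp_all add: v_def)
      have "g' = g"
        by (rule unique_eq[OF univ[OF T]]) (use g eq g' in \<open>simp_all add: g'_def\<close>)
      then show "u = zsing g" by (auto simp: g'_def)
    qed
  qed
  assume k: "k < zlen A"
  show "block_colimit hs k (sobj A ! k) (S k) (R k)"
    unfolding block_colimit_def
  proof (intro conjI allI impI B(3)[OF k])
    fix p' S' R' assume b: "block_cocone hs k p' S' R'"
    \<comment> \<open>The block under test at position \<open>k\<close>, terminal objects elsewhere: mediating maps into \<open>T\<close> have
       the identity as monotone part and are determined by their component at \<open>k\<close>.\<close>
    define P SS RR where "P = (\<lambda>l. if l = k then p' else t)" and "SS = (\<lambda>l. if l = k then S' else TS)"
      and "RR = (\<lambda>l. if l = k then R' else TR)"
    define T where "T = glued (zlen A) hs P RR j0"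
    have "block_cocone hs l (P l) (SS l) (RR l)" for l
      using b tb[OF B(2)] by (simp add: P_def SS_def RR_def)
    then have T: "sliced_cocone T hs SS RR" and zT: "zlen T = zlen A"
      and sT: "\<And>l. l < zlen A \<Longrightarrow> sobj T ! l = P l"
      using glued_sliced[OF B(2) _ j0] unfolding T_def by simp_all
    let ?id = "Ident Delta (zlen A)"
    have id: "mono_comp ?id (hs j) = hs j" if "j \<in> Obj J" for j
      using Ident_Delta_comp[of "hs j"] sing_coconeD[OF B(2) that] by simp
    obtain g where g: "is_zmap C g" "zdom g = A" "zcod g = T"
      and eq: "\<forall>j\<in>Obj J. zmap_comp C g (leg A hs S j) = leg T hs SS j"
      using univ[OF T] by blast
    note M = mediating_zmapD[OF A g eq]
    have "\<exists>!u. (is_mono_map u \<and> mdom u = zlen A \<and> mcod u = zlen A) \<and>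
        (\<forall>j\<in>Obj J. mono_comp u (hs j) = hs j)"
      using sc B(2) unfolding sing_colimit_def by blast
    then have sg: "zsing g = ?id"
      by (rule unique_eq) (use M(1-4) zT id in \<open>simp_all add: Ident_Delta_simps\<close>)
    have gk: "zcomp g ! k \<in> Hom C (sobj A ! k) p'" "sing_compat hs k (zcomp g ! k) (S k) S'"
      using M(5,6)[OF k] sT[OF k] k by (simp_all add: sg Ident_Delta_simps P_def SS_def)
    obtain w where w: "w \<in> Obj J" "dual (hs w) k < dual (hs w) (Suc k)"
      using sing_colimit_surj[OF sc k] by blast
    show "\<exists>!x. x \<in> Hom C (sobj A ! k) p' \<and> sing_compat hs k x (S k) S' \<and> reg_compat hs k x (R k) R'"
    proof (rule ex1I[of _ "zcomp g ! k"])
      show "zcomp g ! k \<in> Hom C (sobj A ! k) p' \<and> sing_compat hs k (zcomp g ! k) (S k) S' \<and>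
          reg_compat hs k (zcomp g ! k) (R k) R'"
        using gk reg_compat_if_sing_compat[OF B(2) B(3)[OF k] b gk(1) w gk(2)] by blast
      fix x assume x: "x \<in> Hom C (sobj A ! k) p' \<and> sing_compat hs k x (S k) S' \<and>
          reg_compat hs k x (R k) R'"
      define v where "v = map (\<lambda>l. if l = k then x else tm (sobj A ! l)) [0..<zlen A]"
      define g' where "g' = \<lparr>zdom = A, zcod = T, zsing = ?id, zcomp = v\<rparr>"
      have vl: "v ! l = (if l = k then x else tm (sobj A ! l))" if "l < zlen A" for l
        using that by (simp add: v_def)
      have l: "v ! l \<in> Hom C (sobj A ! l) (sobj T ! (vals ?id ! l))"
        "sing_compat hs l (v ! l) (S l) (SS (vals ?id ! l))"
        "reg_compat hs l (v ! l) (R l) (RR (vals ?id ! l))" if "l < zlen A" for l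
        using x tm[OF zigzag_simps(6)[OF B(1) that]] tS[OF that] tR[OF that] sT[OF that] that
        by (simp_all add: vl Ident_Delta_simps P_def SS_def RR_def)
      have g': "is_zmap C g'"
        "\<And>j. j \<in> Obj J \<Longrightarrow> zmap_comp C g' (leg A hs S j) = leg T hs SS j"
        using mediating_zmap[OF A T, of ?id v] l id zT unfolding g'_def
        by (simp_all add: v_def Ident_Delta_simps)
      have "g' = g"
        by (rule unique_eq[OF univ[OF T]]) (use g eq g' in \<open>simp_all add: g'_def\<close>)
      then have "zcomp g ! k = v ! k" by (auto simp: g'_def)
      then show "x = zcomp g ! k" using vl[OF k] by simp
    qed
  qed
qed

end


section \<open>The output of the procedure\<close>

lemma concat_below_zconcat:
  assumes "0 < n" "\<And>k. k < n \<Longrightarrow>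
    X k = \<lparr>robj = [r k, r (Suc k)], sobj = [s k], fwd = [f k], bwd = [b k]\<rparr>"
  shows "concat_below zconcat X n =
    \<lparr>robj = map r [0..<Suc n], sobj = map s [0..<n], fwd = map f [0..<n], bwd = map b [0..<n]\<rparr>"
  using assms
proof (induction n rule: nat_induct_non_zero)
  case (Suc n)
  then obtain m where m: "n = Suc m" by (cases n) auto
  then show ?case using Suc by (simp add: zconcat_def)
qed simp

lemma zconcat_zrestrict:
  fixes Z :: "('o, 'm) zigzag"
  assumes "x \<le> y"
  shows "zconcat (zrestrict Z 0 x) (zrestrict Z x y) = zrestrict Z 0 y"
proof -
  have "tl (slice x (y + 1) xs) = slice (x + 1) (y + 1) xs" for xs :: "'o list"
    using assms by (simp add: slice_def tl_take tl_drop drop_Suc Suc_diff_le)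
  then show ?thesis
    using assms by (simp add: zconcat_def zrestrict_def slice_append)
qed

lemma zrestrict_all: "is_zigzag C Z \<Longrightarrow> zrestrict Z 0 (zlen Z) = Z"
  using zigzag_simps(1-4)[of C Z] by (simp add: zrestrict_def slice_def)

context zigzag_diagram
begin

text \<open>The forward and backward map of a block are the legs of its cocone at the two cut points,
  whichever index \<open>w\<close> with a singular object in the block is used to compute them.\<close>

lemma block_glue:
  assumes hs: "sing_cocone n hs" and b: "block_cocone hs k p S R"
    and w: "w \<in> Obj J" "0 < zlen (FObj (piece J D hs k) w)"
  shows "block C (piece J D hs k) p (glue hs k S R) w =
    \<lparr>robj = [robj (Z w) ! dual (hs w) k, robj (Z w) ! dual (hs w) (Suc k)], sobj = [p],
     fwd = [R w (dual (hs w) k)], bwd = [R w (dual (hs w) (Suc k))]\<rparr>"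
proof -
  define a b' where "a = dual (hs w) k" and "b' = dual (hs w) (Suc k)"
  note P = piece_obj[where l = k, OF hs w(1), folded a_def b'_def]
  note B' = block_coconeD(3-5)[OF b w(1), folded a_def b'_def]
  have lt: "a < b'" using w(2) P(2) by simp
  have "Comp C (S w a) (fwd (Z w) ! a) = R w a"
    using B'(1)[of a] lt by (simp add: a_def b'_def)
  moreover have "Comp C (S w (b' - 1)) (bwd (Z w) ! (b' - 1)) = R w b'"
    using B'(2)[of "b' - 1"] lt by (simp add: a_def b'_def)
  moreover have "Dom C (R w a) = robj (Z w) ! a" "Dom C (R w b') = robj (Z w) ! b'"
    using B'(3)[of a] B'(3)[of b'] lt by (simp_all add: a_def b'_def Hom_def)
  moreover have "a + (b' - a - 1) = b' - 1" using lt by simp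
  ultimately show ?thesis
    unfolding a_def[symmetric] b'_def[symmetric]
    using lt P(4)[of 0] P(5)[of "b' - a - 1"]
    by (simp add: block_def P(2) Let_def glue_def flip: a_def)
qed

lemma proc_apex_eq:
  assumes hs: "sing_cocone c cs" and b: "\<And>k. k < c \<Longrightarrow> block_cocone cs k (p k) (S k) (R k)"
    and \<phi>: "\<And>k. k < c \<Longrightarrow> \<phi> k = glue cs k (S k) (R k)"
    and w: "\<And>k. k < c \<Longrightarrow> w k \<in> Obj J \<and> 0 < zlen (FObj (piece J D cs k) (w k))"
    and j0: "j0 \<in> Obj J"
  shows "proc_apex C J D c cs p \<phi> w j0 = glued c cs p R j0"
proof (cases "c = 0")
  case True
  then have N: "N j0 = 0" using sing_cocone_dual_ends[OF hs j0] by simp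
  note z = zigzag_simps(1-4)[OF Z_zigzag[OF j0]]
  have "dual (cs j0) 0 = 0" using sing_cocone_dual_ends[OF hs j0] by simp
  moreover have "robj (Z j0) = [robj (Z j0) ! 0]"
    using z(1) N by (cases "robj (Z j0)") auto
  ultimately show ?thesis
    using True z N by (simp add: proc_apex_def glued_def)
next
  case False
  have "block C (piece J D cs k) (p k) (\<phi> k) (w k) =
      \<lparr>robj = [robj (Z j0) ! dual (cs j0) k, robj (Z j0) ! dual (cs j0) (Suc k)], sobj = [p k],
       fwd = [R k j0 (dual (cs j0) k)], bwd = [R k j0 (dual (cs j0) (Suc k))]\<rparr>" if k: "k < c" for k
    using block_glue[OF hs b[OF k], of "w k"] w[OF k] block_ends_const[OF hs b[OF k] j0, of "w k"]
      robj_dual_const[OF hs j0, of "w k"] by (simp add: \<phi>[OF k])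
  then have "concat_below zconcat (\<lambda>k. block C (piece J D cs k) (p k) (\<phi> k) (w k)) c =
      glued c cs p R j0"
    unfolding glued_def using False by (intro concat_below_zconcat) simp_all
  then show ?thesis using False by (simp add: proc_apex_def)
qed

text \<open>Stated for initial segments of the blocks, since concatenation proceeds from the left.\<close>

lemma concat_block_legs:
  assumes hs: "sing_cocone c cs" and j: "j \<in> Obj J" and n: "0 < n" "n \<le> c"
    and \<phi>: "\<And>k. k < c \<Longrightarrow> \<phi> k = glue cs k (S k) (R k)"
  shows "concat_below zmap_concat (\<lambda>k. block_leg (piece J D cs k) (B k) (\<phi> k) j) n =
    \<lparr>zdom = zrestrict (Z j) 0 (dual (cs j) n), zcod = concat_below zconcat B n,
     zsing = \<lparr>vals = take (dual (cs j) n) (vals (cs j)), mcod = n\<rparr>,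
     zcomp = map (\<lambda>i. S (vals (cs j) ! i) j i) [0..<dual (cs j) n]\<rparr>"
  using n
proof (induction n rule: nat_induct_non_zero)
  let ?X = "\<lambda>k. block_leg (piece J D cs k) (B k) (\<phi> k) j" and ?a = "\<lambda>k. dual (cs j) k"
  have fib: "vals (cs j) ! i = k" if "?a k \<le> i" "i < ?a (Suc k)" for i k
  proof -
    have "i < N j" using that(2) sing_cocone_dual_le(1)[OF hs j, of "Suc k"] by linarith
    then show ?thesis using sing_cocone_fibre[OF hs j] that by simp
  qed
  have len: "length (vals (cs j)) = N j"
    using sing_coconeD(2)[OF hs j] by (simp add: mdom_def)
  have le: "?a k \<le> ?a (Suc k)" "?a k \<le> N j" for k
    using sing_cocone_dual_le[OF hs j] by auto
  have X: "?X k = \<lparr>zdom = zrestrict (Z j) (?a k) (?a (Suc k)), zcod = B k,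
      zsing = \<lparr>vals = replicate (?a (Suc k) - ?a k) 0, mcod = 1\<rparr>,
      zcomp = map (\<lambda>i. S (vals (cs j) ! (?a k + i)) j (?a k + i)) [0..<?a (Suc k) - ?a k]\<rparr>"
    if "k < c" for k
    using fib[of k] piece_obj(1,2)[OF hs j, of k]
    by (simp add: block_leg_def \<phi>[OF that] glue_def Let_def)
  have vals: "take (?a k) (vals (cs j)) @ replicate (?a (Suc k) - ?a k) k = take (?a (Suc k)) (vals (cs j))"
    for k
  proof (rule nth_equalityI)
    fix i assume "i < length (take (?a k) (vals (cs j)) @ replicate (?a (Suc k) - ?a k) k)"
    then have "i < ?a (Suc k)" using le[of k] len by auto
    then show "(take (?a k) (vals (cs j)) @ replicate (?a (Suc k) - ?a k) k) ! i =
        take (?a (Suc k)) (vals (cs j)) ! i"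
      using fib[of k i] le[of k] len by (auto simp: nth_append)
  qed (use le[of k] le(2)[of "Suc k"] len in auto)
  have comps: "map F [0..<?a k] @ map (\<lambda>i. F (?a k + i)) [0..<?a (Suc k) - ?a k] = map F [0..<?a (Suc k)]"
    for k and F :: "nat \<Rightarrow> 'm"
    by (rule nth_equalityI) (use le[of k] in \<open>auto simp: nth_append\<close>)
  {
    case 1
    have "?a 0 = 0" using sing_cocone_dual_ends[OF hs j] by simp
    then show ?case
      using X[of 0] vals[of 0] 1 by simp
  next
    case (Suc n)
    then obtain m where m: "n = Suc m" by (cases n) auto
    have nc: "n < c" using Suc by simp
    have "concat_below zmap_concat ?X (Suc n) = zmap_concat (concat_below zmap_concat ?X n) (?X n)"
      by (simp add: m)
    also have "concat_below zmap_concat ?X n =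
      \<lparr>zdom = zrestrict (Z j) 0 (?a n), zcod = concat_below zconcat B n,
       zsing = \<lparr>vals = take (?a n) (vals (cs j)), mcod = n\<rparr>,
       zcomp = map (\<lambda>i. S (vals (cs j) ! i) j i) [0..<?a n]\<rparr>"
      using Suc by simp
    also have "zmap_concat \<dots> (?X n) =
      \<lparr>zdom = zrestrict (Z j) 0 (?a (Suc n)), zcod = zconcat (concat_below zconcat B n) (B n),
       zsing = \<lparr>vals = take (?a (Suc n)) (vals (cs j)), mcod = Suc n\<rparr>,
       zcomp = map (\<lambda>i. S (vals (cs j) ! i) j i) [0..<?a (Suc n)]\<rparr>"
      unfolding zmap_concat_def X[OF nc]
      using vals[of n] comps[of "\<lambda>i. S (vals (cs j) ! i) j i" n]
      by (simp add: zconcat_zrestrict[OF le(1)] map_replicate_const del: upt_Suc)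
    also have "zconcat (concat_below zconcat B n) (B n) = concat_below zconcat B (Suc n)"
      by (simp add: m)
    finally show ?case .
  }
qed

lemma proc_leg_eq:
  assumes hs: "sing_cocone c cs" and b: "\<And>k. k < c \<Longrightarrow> block_cocone cs k (p k) (S k) (R k)"
    and \<phi>: "\<And>k. k < c \<Longrightarrow> \<phi> k = glue cs k (S k) (R k)"
    and w: "\<And>k. k < c \<Longrightarrow> w k \<in> Obj J \<and> 0 < zlen (FObj (piece J D cs k) (w k))"
    and j0: "j0 \<in> Obj J" and j: "j \<in> Obj J"
  shows "proc_leg C J D c cs p \<phi> w j = leg (glued c cs p R j0) cs S j"
proof -
  have apex: "proc_apex C J D c cs p \<phi> w j' = glued c cs p R j'" if "j' \<in> Obj J" for j'
    using hs b \<phi> w that by (rule proc_apex_eq)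
  show ?thesis
  proof (cases "c = 0")
    case True
    \<comment> \<open>A monotone map into the empty ordinal has empty domain, so all \<open>D(j)\<close> have length 0 and, by
       connectedness, the same regular object.\<close>
    then have N: "N j = 0" using sing_cocone_dual_ends[OF hs j] by simp
    have "glued c cs p R j0 = glued c cs p R j"
      using True robj_dual_const[OF hs j j0] by (simp add: glued_def)
    then have Zj: "glued c cs p R j0 = Z j"
      using apex[OF j] True by (simp add: proc_apex_def)
    have cs: "cs j = Ident Delta (N j)"
      by (rule mono_map_eqI) (use sing_coconeD[OF hs j] N True in \<open>simp_all add: Ident_Delta_simps\<close>)
    have "sobj (Z j) = []" using N by (simp add: zlen_def)
    then show ?thesis
      unfolding Zj using True N by (simp add: proc_leg_def zid_def leg_def cs)
  next
    case False
    let ?B = "\<lambda>k. block C (piece J D cs k) (p k) (\<phi> k) (w k)"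
    have "concat_below zconcat ?B c = glued c cs p R j0"
      using apex[OF j0] False by (simp add: proc_apex_def)
    moreover have "dual (cs j) c = N j" using sing_cocone_dual_ends[OF hs j] by simp
    moreover have "zrestrict (Z j) 0 (N j) = Z j" by (rule zrestrict_all[OF Z_zigzag[OF j]])
    moreover have "take (N j) (vals (cs j)) = vals (cs j)"
      using sing_coconeD(2)[OF hs j] by (simp add: mdom_def)
    moreover have "\<lparr>vals = vals (cs j), mcod = c\<rparr> = cs j"
      using sing_coconeD(3)[OF hs j] by simp
    ultimately show ?thesis
      using concat_block_legs[OF hs j _ order_refl \<phi>, of ?B] False
      by (simp add: proc_leg_def leg_def)
  qed
qed

lemma procedure_colimit:
  assumes c: "sing_colimit c cs"
    and p: "\<And>k. k < c \<Longrightarrow> is_colimit C (deconstruction C J (piece J D cs k)) (p k) (\<phi> k)"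
    and w: "\<And>k. k < c \<Longrightarrow> w k \<in> Obj J \<and> 0 < zlen (FObj (piece J D cs k) (w k))"
    and j0: "j0 \<in> Obj J"
  shows "is_colimit (Zigzags C) (ftor_diagram J D)
    (proc_apex C J D c cs p \<phi> w j0) (proc_leg C J D c cs p \<phi> w)"
proof -
  have cs: "sing_cocone c cs" using c by (simp add: sing_colimit_def)
  define S R where "S = (\<lambda>k j i. \<phi> k (SVert j (i - dual (cs j) k)))"
    and "R = (\<lambda>k j i. \<phi> k (RVert j (i - dual (cs j) k)))"
  have \<phi>: "\<phi> k = glue cs k (S k) (R k)" for k
    unfolding S_def R_def by (rule glue_unglue[symmetric])
  have bc: "block_colimit cs k (p k) (S k) (R k)" if "k < c" for k
    using p[OF that] unfolding \<phi>[of k] piece_colimit_iff[OF cs] .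
  then have b: "block_cocone cs k (p k) (S k) (R k)" if "k < c" for k
    using that by (simp add: block_colimit_def)
  let ?A = "glued c cs p R j0"
  have apex: "proc_apex C J D c cs p \<phi> w j0 = ?A"
    by (rule proc_apex_eq[where S = S, OF cs b \<phi> w j0])
  have legs: "proc_leg C J D c cs p \<phi> w j = leg ?A cs S j" if "j \<in> Obj J" for j
    by (rule proc_leg_eq[OF cs b \<phi> w j0 that])
  have "is_colimit (Zigzags C) (ftor_diagram J D) ?A (leg ?A cs S)"
    by (rule sliced_colimit[OF glued_sliced[OF cs b j0]]) (use c bc in simp_all)
  moreover have "is_cocone (Zigzags C) (ftor_diagram J D) ?A (leg ?A cs S) \<longleftrightarrow>
      is_cocone (Zigzags C) (ftor_diagram J D) ?A (proc_leg C J D c cs p \<phi> w)"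
    using legs J.dom_obj J.cod_obj by (simp add: is_cocone_def ftor_diagram_def)
  moreover have "(\<forall>j\<in>Obj J. zmap_comp C g (leg ?A cs S j) = X j) \<longleftrightarrow>
      (\<forall>j\<in>Obj J. zmap_comp C g (proc_leg C J D c cs p \<phi> w j) = X j)" for g X
    using legs by simp
  ultimately show ?thesis
    unfolding apex zigzag_colimit_iff by simp
qed

lemma colimit_procedure:
  assumes "has_terminal C" and colim: "is_colimit (Zigzags C) (ftor_diagram J D) A \<psi>"
  shows "\<exists>c cs. sing_colimit c cs \<and> (\<forall>k<c. has_colimit C (deconstruction C J (piece J D cs k)))"
proof -
  have coc: "is_cocone (Zigzags C) (ftor_diagram J D) A \<psi>"
    using colim by (simp add: is_colimit_def)
  define hs S R where "hs = (\<lambda>j. zsing (\<psi> j))" and "S = (\<lambda>(l::nat) j i. zcomp (\<psi> j) ! i)"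
    and "R = (\<lambda>l j i. reg_arrow C (\<psi> j) l i)"
  have A: "sliced_cocone A hs S R" and \<psi>: "\<And>j. j \<in> Obj J \<Longrightarrow> \<psi> j = leg A hs S j"
    using cocone_sliced[OF coc] unfolding hs_def S_def R_def by blast+
  have univ: "\<exists>!g. (is_zmap C g \<and> zdom g = A \<and> zcod g = A') \<and>
      (\<forall>j\<in>Obj J. zmap_comp C g (leg A hs S j) = leg A' hs' S' j)"
    if "sliced_cocone A' hs' S' R'" for A' hs' S' R'
  proof -
    have "\<exists>!g. (is_zmap C g \<and> zdom g = A \<and> zcod g = A') \<and>
        (\<forall>j\<in>Obj J. zmap_comp C g (\<psi> j) = leg A' hs' S' j)"
      using colim sliced_cocone_is_cocone[OF that] unfolding zigzag_colimit_iff by blast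
    then show ?thesis using \<psi> by (simp cong: ball_cong)
  qed
  have slices: "sing_colimit (zlen A) hs"
    "\<And>k. k < zlen A \<Longrightarrow> block_colimit hs k (sobj A ! k) (S k) (R k)"
    by (rule colimit_slices[OF assms(1) A], erule univ, assumption?)+
  have "has_colimit C (deconstruction C J (piece J D hs k))" if "k < zlen A" for k
    using slices(2)[OF that] piece_colimit_iff[OF sliced_coconeD(2)[OF A]]
    unfolding has_colimit_def by blast
  then show ?thesis using slices(1) by blast
qed

lemma ex_nonempty_piece:
  assumes c: "sing_colimit c cs" and k: "k < c"
  shows "\<exists>j\<in>Obj J. 0 < zlen (FObj (piece J D cs k) j)"
proof -
  obtain j where j: "j \<in> Obj J" "dual (cs j) k < dual (cs j) (Suc k)"
    using sing_colimit_surj[OF c k] by blast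
  moreover have "sing_cocone c cs" using c by (simp add: sing_colimit_def)
  ultimately show ?thesis using piece_obj(2)[of c cs j k] by (intro bexI[of _ j]) simp_all
qed

end

theorem theorem33:
  fixes C :: "('o, 'm) cat"
    and J :: "('j, 'a) cat"
    and D :: "('j, 'a, ('o, 'm) zigzag, ('o, 'm) zmap) ftor"
  assumes "category C" and "has_terminal C"
    and "category J" and "connected_cat J"
    and "is_functor J (Zigzags C) D"
  shows
    "(has_colimit (Zigzags C) (ftor_diagram J D) \<longleftrightarrow>
        (\<exists>c cs. is_colimit Delta (ftor_diagram J (ftor_comp Sing D)) c cs \<and>
                (\<forall>k<c. has_colimit C (deconstruction C J (piece J D cs k)))))
     \<and>
     (\<forall>c cs p \<phi>.
        is_colimit Delta (ftor_diagram J (ftor_comp Sing D)) c cs \<and>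
        (\<forall>k<c. is_colimit C (deconstruction C J (piece J D cs k)) (p k) (\<phi> k)) \<longrightarrow>
          (\<forall>k<c. \<exists>j\<in>Obj J. 0 < zlen (FObj (piece J D cs k) j)) \<and>
          (\<forall>w j\<^sub>0. (\<forall>k<c. w k \<in> Obj J \<and> 0 < zlen (FObj (piece J D cs k) (w k))) \<and> j\<^sub>0 \<in> Obj J \<longrightarrow>
             is_colimit (Zigzags C) (ftor_diagram J D)
               (proc_apex C J D c cs p \<phi> w j\<^sub>0) (proc_leg C J D c cs p \<phi> w)))"
proof -
  interpret zigzag_diagram C J D
    using assms by (simp add: zigzag_diagram_def zigzag_diagram_axioms_def)
  show ?thesis
    unfolding sing_colimit_iff
  proof (intro conjI iffI allI impI)
    assume "has_colimit (Zigzags C) (ftor_diagram J D)"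
    then show "\<exists>c cs. sing_colimit c cs \<and> (\<forall>k<c. has_colimit C (deconstruction C J (piece J D cs k)))"
      using colimit_procedure[OF assms(2)] unfolding has_colimit_def by blast
  next
    assume "\<exists>c cs. sing_colimit c cs \<and> (\<forall>k<c. has_colimit C (deconstruction C J (piece J D cs k)))"
    then obtain c cs where c: "sing_colimit c cs"
      and ex: "\<forall>k<c. \<exists>p \<phi>. is_colimit C (deconstruction C J (piece J D cs k)) p \<phi>"
      unfolding has_colimit_def by blast
    obtain p \<phi> where p: "\<And>k. k < c \<Longrightarrow> is_colimit C (deconstruction C J (piece J D cs k)) (p k) (\<phi> k)"
      using ex by metis
    obtain w where w: "\<And>k. k < c \<Longrightarrow> w k \<in> Obj J \<and> 0 < zlen (FObj (piece J D cs k) (w k))"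
      using ex_nonempty_piece[OF c] by metis
    obtain j0 where "j0 \<in> Obj J" using ex_obj by blast
    from procedure_colimit[OF c p w this] show "has_colimit (Zigzags C) (ftor_diagram J D)"
      unfolding has_colimit_def by blast
  next
    fix c cs p \<phi> k
    assume "sing_colimit c cs \<and>
      (\<forall>k<c. is_colimit C (deconstruction C J (piece J D cs k)) (p k) (\<phi> k))" and "k < c"
    then show "\<exists>j\<in>Obj J. 0 < zlen (FObj (piece J D cs k) j)"
      using ex_nonempty_piece by blast
  next
    fix c cs p \<phi> w j0
    assume "sing_colimit c cs \<and>
      (\<forall>k<c. is_colimit C (deconstruction C J (piece J D cs k)) (p k) (\<phi> k))"
      and "(\<forall>k<c. w k \<in> Obj J \<and> 0 < zlen (FObj (piece J D cs k) (w k))) \<and> j0 \<in> Obj J"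
    then show "is_colimit (Zigzags C) (ftor_diagram J D)
        (proc_apex C J D c cs p \<phi> w j0) (proc_leg C J D c cs p \<phi> w)"
      by (intro procedure_colimit) auto
  qed
qed

end
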